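(* Let $\Xi=\bigcup_{n\in\mathbb{N}}(X_n+\Xi(n))$ be a Boolean model on $\mathbb{R}^d$ with germs $\{X_n\}$ and grains $\{\Xi(n)\}$. If there exist positive constants $r_0$, $C_1$, $C_2$ such that $\mathbb{P}(\Xi(n)\cap B(\mathbf 0,r)^c\ne\emptyset)\le C_1\exp(-C_2r)$ for all $r\ge r_0$, then $\Xi$ satisfies the EDD.
   Context: Boolean model. A point process $\Xi=\bigcup_{n\in\mathbb{N}}(X_n+\Xi(n))$ on $\mathbb{R}^d$ is a germ-grain model if the grains $\{\Xi(n)\}_{n\in\mathbb{N}}$ are i.i.d. point processes, and the germs $\{X_n\}$ are independent of $\{\Xi(n)\}_{n\in\mathbb{N}}$ and form a stationary point process $\Xi'=\sum_{n\in\mathbb{N}}\delta_{X_n}$. It is a Boolean model if $\Xi'$ is Poisson. $B(\mathbf 0,r)$ is the ball of radius $r$ centred at the origin. EDD. For $A_1,A_2\in\mathscr B(\mathbb{R}^d)$, with $\Xi_A$ the restriction of $\Xi$ to $A$, the $\beta$-mixing coefficient is $\beta_{A_1,A_2}=\frac12\int\int|\mathbb{P}(\Xi_{A_1}\in d\zeta_1,\Xi_{A_2}\in d\zeta_2)-\mathbb{P}(\Xi_{A_1}\in d\zeta_1)\mathbb{P}(\Xi_{A_2}\in d\zeta_2)|$ (integration over configurations on $A_1$ and $A_2$). $\mathrm{diam}(A)=\sup\{\|x-y\|:x,y\in A\}$, $d(A,B)=\inf\{\|x-y\|:x\in A,y\in B\}$, $\sup\emptyset=0$, $\inf\emptyset=\infty$.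 $\Xi$ has exponentially decay dependence (EDD) if there are constants $\theta_0\ge0$, $\theta_1,\dots,\theta_4>0$ such that $\beta_{A,B}\le\theta_1(\mathrm{diam}(A)^{\theta_0}\vee1)(\mathrm{diam}(B)^{\theta_0}\vee1)e^{-\theta_2d(A,B)}$ for all Borel $A,B$ with $d(A,B)\ge\theta_3\ln(\mathrm{diam}(A)\vee\mathrm{diam}(B)\vee\theta_4)$. *)

theory Defs
  imports "HOL-Probability.Probability"
begin

section \<open>Point processes\<close>

text \<open>
  Configurations are locally finite, integer-valued Borel measures, so points may have
  multiplicities.  As for \<^const>\<open>subprob_algebra\<close>, the \<open>\<sigma>\<close>-algebra is generated by the
  evaluation maps \<open>\<mu> \<mapsto> \<mu> B\<close>.
\<close>

definition config_algebra :: "'a::euclidean_space measure measure" where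
  "config_algebra =
    (SUP B \<in> sets borel. vimage_algebra
      {\<mu>. sets \<mu> = sets borel \<and> (\<forall>B\<in>sets borel. bounded B \<longrightarrow> emeasure \<mu> B \<in> \<nat>)}
      (\<lambda>\<mu>. emeasure \<mu> B) borel)"

definition point_process :: "'w measure \<Rightarrow> ('w \<Rightarrow> 'a::euclidean_space measure) \<Rightarrow> bool" where
  "point_process M \<Xi> \<longleftrightarrow> \<Xi> \<in> measurable M config_algebra"

definition restrict_config :: "'a::euclidean_space set \<Rightarrow> 'a measure \<Rightarrow> 'a measure" where
  "restrict_config A \<mu> = density \<mu> (indicator A)"

definition translate_config :: "'a::euclidean_space \<Rightarrow> 'a measure \<Rightarrow> 'a measure" where
  "translate_config x \<mu> = distr \<mu> borel (\<lambda>y. x + y)"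

text \<open>
  The union of configurations, where points are counted with multiplicity.  When the configurations
  are simple and pairwise disjoint this is the counting measure of the union of their supports.
\<close>

definition superpose :: "(nat \<Rightarrow> 'a::euclidean_space measure) \<Rightarrow> 'a measure" where
  "superpose \<mu> = measure_of UNIV (sets borel) (\<lambda>B. \<Sum>n. emeasure (\<mu> n) B)"

definition stationary_process :: "'w measure \<Rightarrow> ('w \<Rightarrow> 'a::euclidean_space measure) \<Rightarrow> bool" where
  "stationary_process M \<Xi> \<longleftrightarrow> point_process M \<Xi> \<and>
    (\<forall>x. distr M config_algebra (\<lambda>\<omega>. translate_config x (\<Xi> \<omega>)) = distr M config_algebra \<Xi>)"

definition poisson_process :: "'w measure \<Rightarrow> ('w \<Rightarrow> 'a::euclidean_space measure) \<Rightarrow> bool" where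
  "poisson_process M \<Xi> \<longleftrightarrow> point_process M \<Xi> \<and>
    (\<exists>\<Lambda>. sets \<Lambda> = sets borel \<and>
      (\<forall>B\<in>sets borel. bounded B \<longrightarrow> emeasure \<Lambda> B < \<infinity> \<and>
        (\<forall>k::nat. measure M {\<omega>\<in>space M. emeasure (\<Xi> \<omega>) B = of_nat k}
          = measure \<Lambda> B ^ k / fact k * exp (- measure \<Lambda> B)))) \<and>
    (\<forall>F. finite F \<and> disjoint F \<and> (\<forall>B\<in>F. B \<in> sets borel \<and> bounded B) \<longrightarrow>
      prob_space.indep_vars M (\<lambda>_. borel) (\<lambda>B \<omega>. emeasure (\<Xi> \<omega>) B) F)"

section \<open>Germ-grain and Boolean models\<close>

text \<open>
  \<open>X n\<close> are the germs, \<open>G n\<close> the grains, \<open>\<Phi>\<close> the germ process and \<open>\<Xi>\<close> the resulting process.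
  The almost sure equalities accommodate null sets on which a superposition is not locally finite.
\<close>

locale germ_grain_model = prob_space M
  for M :: "'w measure" +
  fixes X :: "nat \<Rightarrow> 'w \<Rightarrow> 'a::euclidean_space"
    and G :: "nat \<Rightarrow> 'w \<Rightarrow> 'a measure"
    and \<Phi> :: "'w \<Rightarrow> 'a measure"
    and \<Xi> :: "'w \<Rightarrow> 'a measure"
  assumes germ_measurable: "\<And>n. X n \<in> borel_measurable M"
    and grain_point_process: "\<And>n. point_process M (G n)"
    and grains_indep: "indep_vars (\<lambda>_. config_algebra) G UNIV"
    and grains_ident_distr: "\<And>m n. distr M config_algebra (G m) = distr M config_algebra (G n)"
    and germs_grains_indep:
      "indep_set
        {(\<lambda>\<omega> n. X n \<omega>) -` S \<inter> space M | S. S \<in> sets (Pi\<^sub>M UNIV (\<lambda>_. borel))}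
        {(\<lambda>\<omega> n. G n \<omega>) -` S \<inter> space M | S. S \<in> sets (Pi\<^sub>M UNIV (\<lambda>_. config_algebra))}"
    and germs_eq: "AE \<omega> in M. \<Phi> \<omega> = superpose (\<lambda>n. return borel (X n \<omega>))"
    and germs_stationary: "stationary_process M \<Phi>"
    and point_process_model: "point_process M \<Xi>"
    and model_eq: "AE \<omega> in M. \<Xi> \<omega> = superpose (\<lambda>n. translate_config (X n \<omega>) (G n \<omega>))"

locale boolean_model = germ_grain_model +
  assumes germs_poisson: "poisson_process M \<Phi>"

section \<open>Exponentially decaying dependence\<close>

text \<open>The total variation norm of the signed measure \<open>\<mu> - \<nu>\<close>, for finite \<open>\<mu>\<close> and \<open>\<nu>\<close>.\<close>

definition total_variation :: "'b measure \<Rightarrow> 'b measure \<Rightarrow> ennreal" where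
  "total_variation \<mu> \<nu> =
    (SUP P \<in> {P. finite P \<and> P \<subseteq> sets \<mu> \<and> disjoint P \<and> \<Union>P = space \<mu>}.
      \<Sum>E\<in>P. ennreal \<bar>measure \<mu> E - measure \<nu> E\<bar>)"

definition beta_mixing ::
    "'w measure \<Rightarrow> ('w \<Rightarrow> 'a::euclidean_space measure) \<Rightarrow> 'a set \<Rightarrow> 'a set \<Rightarrow> ennreal" where
  "beta_mixing M \<Xi> A B = total_variation
     (distr M (config_algebra \<Otimes>\<^sub>M config_algebra)
       (\<lambda>\<omega>. (restrict_config A (\<Xi> \<omega>), restrict_config B (\<Xi> \<omega>))))
     (distr M config_algebra (\<lambda>\<omega>. restrict_config A (\<Xi> \<omega>)) \<Otimes>\<^sub>M
      distr M config_algebra (\<lambda>\<omega>. restrict_config B (\<Xi> \<omega>))) / 2"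

text \<open>
  Unlike \<^const>\<open>diameter\<close> and \<^const>\<open>setdist\<close>, these take the value \<open>\<infinity>\<close> on unbounded sets
  and for a distance to the empty set, respectively; the supremum of the empty set is \<open>0\<close> here.
\<close>

definition ediam :: "'a::euclidean_space set \<Rightarrow> ennreal" where
  "ediam A = (SUP (x, y) \<in> A \<times> A. ennreal (norm (x - y)))"

definition esetdist :: "'a::euclidean_space set \<Rightarrow> 'a set \<Rightarrow> ennreal" where
  "esetdist A B = (INF (x, y) \<in> A \<times> B. ennreal (norm (x - y)))"

text \<open>
  Only used at arguments \<open>x > 0\<close> for \<open>ln_ext\<close> and at exponents \<open>a \<ge> 0\<close> for \<open>powr_ext\<close>.
  The value \<open>0 powr 0 = 0\<close> is irrelevant, since powers only occur in a maximum with \<open>1\<close>.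
\<close>

definition ln_ext :: "ennreal \<Rightarrow> ereal" where
  "ln_ext x = (if x = \<infinity> then \<infinity> else ereal (ln (enn2real x)))"

definition powr_ext :: "ennreal \<Rightarrow> real \<Rightarrow> ennreal" where
  "powr_ext x a = (if x = \<infinity> then (if a = 0 then 1 else \<infinity>) else ennreal (enn2real x powr a))"

definition exp_ext :: "ereal \<Rightarrow> ennreal" where
  "exp_ext x = (if x = \<infinity> then \<infinity> else if x = -\<infinity> then 0 else ennreal (exp (real_of_ereal x)))"

text \<open>
  The product \<open>\<infinity> * 0 = 0\<close> can only arise on the right-hand side when \<open>A\<close> or \<open>B\<close> is empty,
  and then the mixing coefficient vanishes.
\<close>

definition EDD :: "'w measure \<Rightarrow> ('w \<Rightarrow> 'a::euclidean_space measure) \<Rightarrow> bool" where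
  "EDD M \<Xi> \<longleftrightarrow>
    (\<exists>\<theta>\<^sub>0 \<theta>\<^sub>1 \<theta>\<^sub>2 \<theta>\<^sub>3 \<theta>\<^sub>4 :: real.
      \<theta>\<^sub>0 \<ge> 0 \<and> \<theta>\<^sub>1 > 0 \<and> \<theta>\<^sub>2 > 0 \<and> \<theta>\<^sub>3 > 0 \<and> \<theta>\<^sub>4 > 0 \<and>
      (\<forall>A\<in>sets borel. \<forall>B\<in>sets borel.
        enn2ereal (esetdist A B)
          \<ge> ereal \<theta>\<^sub>3 * ln_ext (max (max (ediam A) (ediam B)) (ennreal \<theta>\<^sub>4)) \<longrightarrow>
        beta_mixing M \<Xi> A B
          \<le> ennreal \<theta>\<^sub>1 * max (powr_ext (ediam A) \<theta>\<^sub>0) 1 * max (powr_ext (ediam B) \<theta>\<^sub>0) 1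
              * exp_ext (- ereal \<theta>\<^sub>2 * enn2ereal (esetdist A B))))"

end

theory Submission
  imports Defs
begin

text \<open>
  Let \<open>s\<close> be the distance of \<open>A\<close> and \<open>B\<close>.  The sets \<open>K\<^sub>A\<close> and \<open>K\<^sub>B\<close> of points closer than \<open>s / 2\<close> to \<open>A\<close>
  and to \<open>B\<close> are disjoint.  Let \<open>Y\<close> be the part inside \<open>A\<close> of the grains whose germs lie in \<open>K\<^sub>A\<close>, and
  \<open>Z\<close> the part inside \<open>B\<close> of those with germs in \<open>K\<^sub>B\<close>.  Then \<open>Y\<close> and \<open>Z\<close> are independent, because a
  Poisson process is completely independent and the grains are i.i.d. marks, and \<open>\<Xi>\<close> agrees with \<open>Y\<close>
  on \<open>A\<close> and with \<open>Z\<close> on \<open>B\<close> unless a grain reaches \<open>A\<close> or \<open>B\<close> from a germ at distance at least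
  \<open>s / 2\<close>.  Replacing \<open>(\<Xi>\<^sub>A, \<Xi>\<^sub>B)\<close> by \<open>(Y, Z)\<close> both in the joint law and in the product of the marginal
  laws therefore bounds the mixing coefficient by twice the sum of the probabilities of these two
  events (\<open>beta_mixing_le_of_coupling\<close>).

  The probability that some grain reaches \<open>A\<close> from afar is bounded by a sum over shells
  (\<open>prob_far_hits_le\<close>).  The shell of germs at distance between \<open>k\<close> and \<open>k + 1\<close> from \<open>A\<close> lies in a ball of
  radius \<open>diam A + k + 1\<close>, so by stationarity its expected number of germs is of order
  \<open>(max (diam A) 1 * (k + 3)) ^ d\<close>, and each of their grains reaches \<open>A\<close> with probability at most
  \<open>C\<^sub>1 * exp (- C\<^sub>2 * (k - 1))\<close>.  Summing over \<open>k \<ge> s / 2 - 1\<close> gives the factor \<open>max (diam A) 1 ^ d\<close> and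
  the exponential decay in \<open>s\<close>, with rate \<open>C\<^sub>2 / 4\<close>, half of the exponent \<open>C\<^sub>2 * s / 2\<close> being spent on the
  polynomial \<open>(k + 3) ^ d\<close>.

  The independence of \<open>Y\<close> and \<open>Z\<close> needs care because the germs are given as a sequence in an arbitrary
  order, which may be correlated with their positions: the indices of the germs in \<open>K\<^sub>A\<close> may carry information
  about those in \<open>K\<^sub>B\<close>.  Products over germs do not see this order.  The expectation of a product of
  marks \<open>a (X n, G n)\<close> over the germs in \<open>K\<close> is that of the product of the averaged marks
  \<open>L (X n)\<close>, where \<open>L x\<close> is the expectation of \<open>a (x, G 0)\<close> (\<open>expectation_prod_germs_in\<close>).  If \<open>L\<close> takes
  finitely many values, the latter is a product of powers whose exponents are the numbers of germs in the
  level sets of \<open>L\<close>, and numbers of germs in disjoint sets are independent; so the expectation of the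
  product over \<open>K\<^sub>A \<union> K\<^sub>B\<close> factorises, for general \<open>L\<close> by approximation
  (\<open>expectation_prod_marks_disjoint\<close>).  Joint exponential moments of the numbers of points of \<open>Y\<close> and
  \<open>Z\<close> in finitely many sets are of this form, and they determine the joint law (\<open>prob_counts_eq_mult\<close>).
\<close>

section \<open>The space of configurations\<close>

lemma space_config_algebra:
  "space config_algebra =
    {\<mu>. sets \<mu> = sets borel \<and> (\<forall>B\<in>sets borel. bounded B \<longrightarrow> emeasure \<mu> B \<in> \<nat>)}"
proof -
  have "sets (borel :: 'a measure) \<noteq> {}"
    using sets.top by blast
  then show ?thesis
    by (simp add: config_algebra_def space_Sup_eq_UN)
qed

lemma measurable_emeasure_config [measurable]:
  "B \<in> sets borel \<Longrightarrow> (\<lambda>\<mu>. emeasure \<mu> B) \<in> borel_measurable config_algebra"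
  unfolding config_algebra_def
  by (erule measurable_SUP1) (simp_all only: measurable_vimage_algebra1 space_vimage_algebra Pi_UNIV space_borel UNIV_I)

lemma sets_config: "\<mu> \<in> space config_algebra \<Longrightarrow> sets \<mu> = sets borel"
  by (simp add: space_config_algebra)

lemma config_bounded_Nats:
  "\<mu> \<in> space config_algebra \<Longrightarrow> B \<in> sets borel \<Longrightarrow> bounded B \<Longrightarrow> emeasure \<mu> B \<in> \<nat>"
  by (simp add: space_config_algebra)

lemma Nats_ennreal_less_top: "(x::ennreal) \<in> \<nat> \<Longrightarrow> x < \<infinity>"
  by (auto elim!: Nats_cases simp: of_nat_less_top)

lemma sum_in_Nats: "(\<And>i. i \<in> I \<Longrightarrow> f i \<in> \<nat>) \<Longrightarrow> sum f I \<in> (\<nat> :: 'b::semiring_1 set)"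
  by (induction I rule: infinite_finite_induct) auto

lemma config_bounded_finite:
  "\<mu> \<in> space config_algebra \<Longrightarrow> B \<in> sets borel \<Longrightarrow> bounded B \<Longrightarrow> emeasure \<mu> B < \<infinity>"
  using config_bounded_Nats Nats_ennreal_less_top by blast

lemma SUP_emeasure_cball:
  fixes \<mu> :: "'a::euclidean_space measure"
  assumes "sets \<mu> = sets borel" "B \<in> sets borel"
  shows "(SUP k::nat. emeasure \<mu> (B \<inter> cball 0 k)) = emeasure \<mu> B"
proof -
  have "incseq (\<lambda>k::nat. B \<inter> cball 0 (real k))"
    by (intro incseq_SucI Int_mono subset_cball) simp_all
  moreover have "range (\<lambda>k::nat. B \<inter> cball 0 (real k)) \<subseteq> sets \<mu>"
    unfolding assms(1) by (intro image_subsetI sets.Int assms(2) borel_closed closed_cball)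
  ultimately have "(SUP k::nat. emeasure \<mu> (B \<inter> cball 0 (real k)))
      = emeasure \<mu> (\<Union>k::nat. B \<inter> cball 0 (real k))"
    by (intro SUP_emeasure_incseq)
  also have "(\<Union>k::nat. B \<inter> cball 0 (real k)) = B"
    by (simp add: set_eq_iff real_arch_simple)
  finally show ?thesis .
qed

text \<open>
  Bounded sets suffice, because the mass of a set is the supremum of the masses of its bounded parts.
\<close>

lemma measurable_config_algebraI:
  fixes f :: "'b \<Rightarrow> 'a::euclidean_space measure"
  assumes sets: "\<And>x. x \<in> space N \<Longrightarrow> sets (f x) = sets borel"
    and nats: "\<And>x B. x \<in> space N \<Longrightarrow> B \<in> sets borel \<Longrightarrow> bounded B \<Longrightarrow> emeasure (f x) B \<in> \<nat>"
    and meas: "\<And>B. B \<in> sets borel \<Longrightarrow> bounded B \<Longrightarrow> (\<lambda>x. emeasure (f x) B) \<in> borel_measurable N"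
  shows "f \<in> measurable N config_algebra"
proof -
  have *: "(\<lambda>x. emeasure (f x) B) \<in> borel_measurable N" if B: "B \<in> sets borel" for B
  proof -
    have "(\<lambda>x. SUP k::nat. emeasure (f x) (B \<inter> cball 0 k)) \<in> borel_measurable N"
      using B by (intro borel_measurable_SUP meas) (auto intro: bounded_Int)
    then show ?thesis
      by (rule measurable_cong[THEN iffD1, rotated]) (simp add: SUP_emeasure_cball sets B)
  qed
  show ?thesis
    unfolding config_algebra_def
  proof (rule measurable_SUP2)
    show "sets (borel :: 'a measure) \<noteq> {}"
      using sets.top by blast
  next
    fix B :: "'a set" assume "B \<in> sets borel"
    then show "f \<in> measurable N (vimage_algebra
        {\<mu>. sets \<mu> = sets borel \<and> (\<forall>B\<in>sets borel. bounded B \<longrightarrow> emeasure \<mu> B \<in> \<nat>)}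
        (\<lambda>\<mu>. emeasure \<mu> B) borel)"
      by (intro measurable_vimage_algebra2 Pi_I CollectI conjI ballI impI sets nats *)
  qed (simp only: space_vimage_algebra)
qed

lemma emeasure_restrict_config:
  assumes "sets \<mu> = sets borel" "A \<in> sets borel" "B \<in> sets borel"
  shows "emeasure (restrict_config A \<mu>) B = emeasure \<mu> (A \<inter> B)"
proof -
  have AB: "A \<in> sets \<mu>" "B \<in> sets \<mu>" "A \<inter> B \<in> sets \<mu>"
    using assms by auto
  have "emeasure (restrict_config A \<mu>) B = (\<integral>\<^sup>+x. indicator A x * indicator B x \<partial>\<mu>)"
    unfolding restrict_config_def by (intro emeasure_density borel_measurable_indicator AB)
  also have "\<dots> = (\<integral>\<^sup>+x. indicator (A \<inter> B) x \<partial>\<mu>)"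
    by (intro nn_integral_cong) (auto split: split_indicator)
  finally show ?thesis
    using AB by simp
qed

lemma sets_restrict_config [simp]: "sets (restrict_config A \<mu>) = sets \<mu>"
  by (simp add: restrict_config_def)

lemma measurable_restrict_config [measurable]:
  assumes A: "A \<in> sets borel"
  shows "restrict_config A \<in> measurable config_algebra config_algebra"
proof (rule measurable_config_algebraI)
  fix B :: "'a set" assume B: "B \<in> sets borel" "bounded B"
  show "(\<lambda>\<mu>. emeasure (restrict_config A \<mu>) B) \<in> borel_measurable config_algebra"
    by (subst measurable_cong[OF emeasure_restrict_config]) (use A B in \<open>auto simp: sets_config\<close>)
  show "emeasure (restrict_config A \<mu>) B \<in> \<nat>" if "\<mu> \<in> space config_algebra" for \<mu>
    using that A B
    by (subst emeasure_restrict_config) (auto simp: sets_config intro!: config_bounded_Nats bounded_Int)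
qed (simp add: sets_config)

lemma sets_translate_config [simp]: "sets (translate_config x \<mu>) = sets borel"
  by (simp add: translate_config_def)

lemma emeasure_translate_config:
  assumes "sets \<mu> = sets borel" "B \<in> sets borel"
  shows "emeasure (translate_config x \<mu>) B = emeasure \<mu> ((\<lambda>y. x + y) -` B)"
proof -
  have "(\<lambda>y. x + y) \<in> measurable \<mu> borel"
    by (subst measurable_cong_sets[OF assms(1) refl]) measurable
  then show ?thesis
    using assms sets_eq_imp_space_eq[OF assms(1)]
    by (simp add: translate_config_def emeasure_distr)
qed

lemma vimage_plus_eq: "(\<lambda>y. x + y) -` B = (\<lambda>y. y - x) ` (B::'a::ab_group_add set)"
  by (force simp: image_iff)

lemma bounded_vimage_plus: "bounded B \<Longrightarrow> bounded ((\<lambda>y. x + y) -` B)"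
  for B :: "'a::euclidean_space set"
  by (simp add: vimage_plus_eq bounded_translation_minus)

lemma sets_vimage_plus: "B \<in> sets borel \<Longrightarrow> (\<lambda>y. x + y) -` B \<in> sets borel"
  for B :: "'a::euclidean_space set"
  using measurable_sets[of "\<lambda>y. x + y" borel borel B] by simp

lemma translate_config_space:
  "\<mu> \<in> space config_algebra \<Longrightarrow> translate_config x \<mu> \<in> space config_algebra"
  by (simp add: space_config_algebra emeasure_translate_config bounded_vimage_plus sets_vimage_plus)

text \<open>
  Joint measurability in the shift and the configuration, which integration over germs and grains
  requires.  A configuration may have infinite mass, so it is cut off at a ball of radius \<open>k\<close> and
  normalised to a subprobability measure; for measurable families of those, evaluation at a section
  of a product set is measurable.
\<close>

lemma measurable_emeasure_translate_config:
  fixes B :: "'a::euclidean_space set"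
  assumes B [measurable]: "B \<in> sets borel"
  shows "(\<lambda>(x, \<mu>). emeasure (translate_config x \<mu>) B) \<in> borel_measurable (borel \<Otimes>\<^sub>M config_algebra)"
proof -
  define c :: "nat \<Rightarrow> 'a measure \<Rightarrow> ennreal" where "c k \<mu> = 1 + emeasure \<mu> (cball 0 k)" for k \<mu>
  define T where "T k \<mu> = scale_measure (inverse (c k \<mu>)) (restrict_config (cball 0 k) \<mu>)"
    for k and \<mu> :: "'a measure"
  have c: "c k \<mu> \<noteq> 0" "c k \<mu> < \<infinity>" if "\<mu> \<in> space config_algebra" for k \<mu>
    using config_bounded_finite[OF that, of "cball 0 k"] by (simp_all add: c_def)
  have [measurable]: "c k \<in> borel_measurable config_algebra" for k
    unfolding c_def by measurable
  have eT: "emeasure (T k \<mu>) C = inverse (c k \<mu>) * emeasure \<mu> (cball 0 k \<inter> C)"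
    if "\<mu> \<in> space config_algebra" "C \<in> sets borel" for k \<mu> C
    using that by (simp add: T_def emeasure_restrict_config sets_config)
  have T [measurable]: "T k \<in> measurable config_algebra (subprob_algebra borel)" for k
  proof (rule measurable_subprob_algebra)
    fix \<mu> :: "'a measure" assume \<mu>: "\<mu> \<in> space config_algebra"
    show sets: "sets (T k \<mu>) = sets borel"
      using \<mu> by (simp add: T_def sets_config)
    have "emeasure (T k \<mu>) UNIV \<le> inverse (c k \<mu>) * c k \<mu>"
      by (subst eT[OF \<mu>]) (auto simp: c_def intro!: mult_left_mono)
    also have "\<dots> = 1"
      using c[OF \<mu>, of k] by (simp add: ennreal_divide_self[unfolded divide_ennreal_def] mult.commute)
    finally show "subprob_space (T k \<mu>)"
      using sets_eq_imp_space_eq[OF sets] by (intro subprob_spaceI) auto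
  next
    fix C :: "'a set" assume C: "C \<in> sets borel"
    have "(\<lambda>\<mu>. inverse (c k \<mu>) * emeasure \<mu> (cball 0 k \<inter> C)) \<in> borel_measurable config_algebra"
      using C by measurable
    then show "(\<lambda>\<mu>. emeasure (T k \<mu>) C) \<in> borel_measurable config_algebra"
      by (rule measurable_cong[THEN iffD1, rotated]) (simp add: eT C)
  qed
  let ?M = "borel \<Otimes>\<^sub>M config_algebra :: ('a \<times> 'a measure) measure"
  have S: "(SIGMA z:space ?M. (\<lambda>y. fst z + y) -` B) \<in> sets (?M \<Otimes>\<^sub>M borel)"
  proof -
    have "{w \<in> space (?M \<Otimes>\<^sub>M borel). fst (fst w) + snd w \<in> B} \<in> sets (?M \<Otimes>\<^sub>M borel)"
      by measurable
    also have "{w \<in> space (?M \<Otimes>\<^sub>M borel). fst (fst w) + snd w \<in> B}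
        = (SIGMA z:space ?M. (\<lambda>y. fst z + y) -` B)"
      by (auto simp: space_pair_measure)
    finally show ?thesis .
  qed
  have "(\<lambda>z. emeasure (T k (snd z)) ((\<lambda>y. fst z + y) -` B)) \<in> borel_measurable ?M" for k
    by (rule emeasure_measurable_subprob_algebra2[OF S]) measurable
  then have "(\<lambda>z. SUP k. c k (snd z) * emeasure (T k (snd z)) ((\<lambda>y. fst z + y) -` B))
      \<in> borel_measurable ?M"
    by measurable
  then show ?thesis
  proof (rule measurable_cong[THEN iffD1, rotated])
    fix z :: "'a \<times> 'a measure" assume "z \<in> space ?M"
    then have \<mu>: "snd z \<in> space config_algebra"
      by (auto simp: space_pair_measure)
    let ?C = "(\<lambda>y. fst z + y) -` B"
    have C: "?C \<in> sets borel" by (rule sets_vimage_plus) fact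
    have "c k (snd z) * (inverse (c k (snd z)) * e) = e" for k e
      using c[OF \<mu>, of k]
      by (simp add: ennreal_divide_self[unfolded divide_ennreal_def] mult.assoc[symmetric])
    then have "(SUP k. c k (snd z) * emeasure (T k (snd z)) ?C)
        = (SUP k::nat. emeasure (snd z) (?C \<inter> cball 0 k))"
      by (simp add: eT[OF \<mu> C] Int_commute)
    also have "\<dots> = emeasure (snd z) ?C"
      by (rule SUP_emeasure_cball[OF sets_config[OF \<mu>] C])
    finally show "(SUP k. c k (snd z) * emeasure (T k (snd z)) ?C)
        = (case z of (x, \<mu>) \<Rightarrow> emeasure (translate_config x \<mu>) B)"
      by (simp add: case_prod_beta emeasure_translate_config[OF sets_config[OF \<mu>]])
  qed
qed

lemma measurable_translate_config [measurable]:
  "translate_config x \<in> measurable config_algebra config_algebra"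
  for x :: "'a::euclidean_space"
proof (rule measurable_config_algebraI)
  fix B :: "'a set" assume B [measurable]: "B \<in> sets borel" and "bounded B"
  have [measurable]: "(\<lambda>y. x + y) -` B \<in> sets borel"
    by (rule sets_vimage_plus) fact
  show "(\<lambda>\<mu>. emeasure (translate_config x \<mu>) B) \<in> borel_measurable config_algebra"
    by (subst measurable_cong[OF emeasure_translate_config]) (auto simp: sets_config)
qed (auto dest: translate_config_space config_bounded_Nats)

lemma sets_superpose [simp]: "sets (superpose \<mu>) = sets borel"
  unfolding superpose_def using sets.space_closed[of borel]
  by (simp add: sets.sigma_sets_eq[of borel, simplified])

lemma emeasure_superpose:
  fixes \<mu> :: "nat \<Rightarrow> 'a::euclidean_space measure"
  assumes sets: "\<And>n. sets (\<mu> n) = sets borel" and B: "B \<in> sets borel"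
  shows "emeasure (superpose \<mu>) B = (\<Sum>n. emeasure (\<mu> n) B)"
proof (rule emeasure_measure_of[OF superpose_def])
  show "countably_additive (sets (superpose \<mu>)) (\<lambda>B. \<Sum>n. emeasure (\<mu> n) B)"
  proof (rule countably_additiveI)
    fix C :: "nat \<Rightarrow> 'a set"
    assume C: "range C \<subseteq> sets (superpose \<mu>)" "disjoint_family C" "\<Union>(range C) \<in> sets (superpose \<mu>)"
    have "(\<Sum>i. \<Sum>n. emeasure (\<mu> n) (C i)) = (\<integral>\<^sup>+i. (\<Sum>n. emeasure (\<mu> n) (C i)) \<partial>count_space UNIV)"
      by (simp add: nn_integral_count_space_nat)
    also have "\<dots> = (\<Sum>n. \<integral>\<^sup>+i. emeasure (\<mu> n) (C i) \<partial>count_space UNIV)"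
      by (rule nn_integral_suminf) simp
    also have "\<dots> = (\<Sum>n. \<Sum>i. emeasure (\<mu> n) (C i))"
      by (simp add: nn_integral_count_space_nat)
    also have "\<dots> = (\<Sum>n. emeasure (\<mu> n) (\<Union>(range C)))"
      using C by (subst suminf_emeasure) (auto simp: sets)
    finally show "(\<Sum>i. \<Sum>n. emeasure (\<mu> n) (C i)) = (\<Sum>n. emeasure (\<mu> n) (\<Union>(range C)))" .
  qed
qed (use B in \<open>auto simp: positive_def\<close>)

text \<open>
  The pairs \<open>(B, k)\<close> prescribe the number of points in \<open>B\<close>.  With arbitrary finite sets of such pairs,
  contradictory ones included, intersections correspond to unions of index sets, which makes this a
  \<open>\<pi>\<close>-system.
\<close>

definition count_events :: "'a::euclidean_space measure set set" where
  "count_events = {{\<mu> \<in> space config_algebra. \<forall>(B, k)\<in>S. emeasure \<mu> B = of_nat k} | S.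
     finite S \<and> (\<forall>(B, k::nat)\<in>S. B \<in> sets borel \<and> bounded B)}"

lemma Int_stable_count_events: "Int_stable count_events"
proof (rule Int_stableI)
  fix a b :: "'a measure set" assume "a \<in> count_events" "b \<in> count_events"
  then obtain S T where "finite S" "\<forall>(B, k::nat)\<in>S. B \<in> sets borel \<and> bounded B"
      "finite T" "\<forall>(B, k::nat)\<in>T. B \<in> sets borel \<and> bounded B"
    and ab: "a = {\<mu> \<in> space config_algebra. \<forall>(B, k)\<in>S. emeasure \<mu> B = of_nat k}"
       "b = {\<mu> \<in> space config_algebra. \<forall>(B, k)\<in>T. emeasure \<mu> B = of_nat k}"
    unfolding count_events_def by blast
  then show "a \<inter> b \<in> count_events"
    unfolding count_events_def by (intro CollectI exI[of _ "S \<union> T"]) auto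
qed

lemma count_events_sets: "count_events \<subseteq> sets config_algebra"
proof
  fix U :: "'a measure set" assume "U \<in> count_events"
  then obtain S where S: "finite S" "\<forall>(B, k::nat)\<in>S. B \<in> sets borel \<and> bounded B"
    and U: "U = {\<mu> \<in> space config_algebra. \<forall>(B, k)\<in>S. emeasure \<mu> B = of_nat k}"
    unfolding count_events_def by blast
  have "{\<mu> \<in> space config_algebra. emeasure \<mu> (fst i) = of_nat (snd i)} \<in> sets config_algebra"
    if "i \<in> S" for i
  proof -
    have [measurable]: "fst i \<in> sets borel"
      using S(2) that by auto
    show ?thesis by measurable
  qed
  then have "{\<mu> \<in> space config_algebra. \<forall>i\<in>S. emeasure \<mu> (fst i) = of_nat (snd i)} \<in> sets config_algebra"
    using S(1) by (intro sets.sets_Collect_finite_All)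
  then show "U \<in> sets config_algebra"
    by (simp add: U case_prod_beta')
qed

lemma count_events_subset: "count_events \<subseteq> Pow (space config_algebra)"
  by (auto simp: count_events_def)

text \<open>
  The number of points in a bounded set is an integer, so its preimages are countable unions of the
  events that fix it.
\<close>

lemma sets_config_algebra_count_events:
  "sets (config_algebra :: 'a::euclidean_space measure measure)
    \<subseteq> sigma_sets (space config_algebra) count_events"
proof
  let ?N = "sigma (space config_algebra) count_events :: 'a measure measure"
  have sp [simp]: "space ?N = space config_algebra"
    by (simp add: space_measure_of count_events_subset)
  have "(\<lambda>\<mu>. \<mu>) \<in> measurable ?N config_algebra"
  proof (rule measurable_config_algebraI)
    fix B :: "'a set" assume B: "B \<in> sets borel" "bounded B"
    show "(\<lambda>\<mu>. emeasure \<mu> B) \<in> borel_measurable ?N"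
    proof (rule measurableI)
      fix E :: "ennreal set" assume "E \<in> sets borel"
      have "(\<lambda>\<mu>. emeasure \<mu> B) -` E \<inter> space ?N
          = (\<Union>k\<in>{k::nat. of_nat k \<in> E}. {\<mu> \<in> space config_algebra. emeasure \<mu> B = of_nat k})"
        using config_bounded_Nats[OF _ B] by (force simp: Nats_def)
      also have "\<dots> \<in> sets ?N"
      proof (rule sets.countable_UN'')
        fix k :: nat
        have "{\<mu> \<in> space config_algebra. emeasure \<mu> B = of_nat k} \<in> count_events"
          unfolding count_events_def using B by (intro CollectI exI[of _ "{(B, k)}"]) auto
        then show "{\<mu> \<in> space config_algebra. emeasure \<mu> B = of_nat k} \<in> sets ?N"
          by (auto simp: sets_measure_of[OF count_events_subset])
      qed auto
      finally show "(\<lambda>\<mu>. emeasure \<mu> B) -` E \<inter> space ?N \<in> sets ?N" .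
    qed simp
  qed (auto simp: sets_config config_bounded_Nats)
  moreover fix E :: "'a measure set" assume "E \<in> sets config_algebra"
  ultimately have "(\<lambda>\<mu>. \<mu>) -` E \<inter> space ?N \<in> sets ?N"
    by (rule measurable_sets)
  moreover have "(\<lambda>\<mu>. \<mu>) -` E \<inter> space ?N = E"
    using sets.sets_into_space[OF \<open>E \<in> sets config_algebra\<close>] by auto
  ultimately show "E \<in> sigma_sets (space config_algebra) count_events"
    by (simp add: sets_measure_of[OF count_events_subset])
qed

section \<open>Joint laws of counts from exponential moments\<close>

text \<open>
  Exponential moments separate the values of an integer variable, one after the other: once the terms
  with \<open>N < k\<close> are known to vanish, multiplying by \<open>exp (t * k)\<close> and letting \<open>t\<close> tend to infinity leaves
  only the term with \<open>N = k\<close>, since \<open>exp (- t * (N - k))\<close> tends to zero for \<open>N > k\<close>.  The weight \<open>W\<close> may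
  have either sign, so that differences can be treated.
\<close>

lemma (in prob_space) expectation_eq_zero_of_count:
  fixes W :: "'a \<Rightarrow> real" and N :: "'a \<Rightarrow> nat"
  assumes [measurable]: "W \<in> borel_measurable M" "N \<in> measurable M (count_space UNIV)"
    and bd: "\<And>\<omega>. \<bar>W \<omega>\<bar> \<le> c"
    and zero: "\<And>t. t \<ge> 0 \<Longrightarrow> expectation (\<lambda>\<omega>. W \<omega> * exp (- t * real (N \<omega>))) = 0"
  shows "expectation (\<lambda>\<omega>. W \<omega> * of_bool (N \<omega> = k)) = 0"
proof (induction k rule: less_induct)
  case (less k)
  define f where "f m \<omega> = W \<omega> * (if k \<le> N \<omega> then exp (- real m * real (N \<omega> - k)) else 0)"
    for m :: nat and \<omega>
  have c: "c \<ge> 0"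
    using bd[of undefined] by linarith
  have [measurable]: "f m \<in> borel_measurable M" for m
    unfolding f_def by measurable
  have bW: "\<bar>W \<omega> * x\<bar> \<le> c" if "\<bar>x\<bar> \<le> 1" for \<omega> x
    using mult_mono[OF bd that] c by (simp add: abs_mult)
  have int: "integrable M (\<lambda>\<omega>. W \<omega> * g \<omega>)"
    if "g \<in> borel_measurable M" "\<And>\<omega>. \<bar>g \<omega>\<bar> \<le> 1" for g
    using that by (intro integrable_const_bound[of _ c] AE_I2) (auto intro: bW)
  \<comment> \<open>For \<open>t = m\<close>, this is the hypothesis multiplied by \<open>exp (m * k)\<close>, without the terms with \<open>N < k\<close>.\<close>
  have f_zero: "expectation (f m) = 0" for m
  proof -
    have split: "exp (real m * k) * exp (- real m * real n)
        = (if k \<le> n then exp (- real m * real (n - k)) else 0)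
          + (\<Sum>j<k. exp (real m * k) * exp (- real m * j) * of_bool (n = j))" for n
    proof -
      have "(\<Sum>j<k. exp (real m * k) * exp (- real m * j) * of_bool (n = j))
          = (\<Sum>j<k. if n = j then exp (real m * k) * exp (- real m * j) else 0)"
        by (intro sum.cong) auto
      also have "\<dots> = (if n < k then exp (real m * k) * exp (- real m * n) else 0)"
        by (simp add: sum.delta')
      finally show ?thesis
        by (simp add: exp_add[symmetric] of_nat_diff algebra_simps)
    qed
    have eq: "exp (real m * k) * (W \<omega> * exp (- real m * real (N \<omega>)))
        = f m \<omega> + (\<Sum>j<k. exp (real m * k) * exp (- real m * j) * (W \<omega> * of_bool (N \<omega> = j)))" for \<omega>
    proof -
      have "exp (real m * k) * (W \<omega> * exp (- real m * real (N \<omega>)))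
          = W \<omega> * (exp (real m * k) * exp (- real m * real (N \<omega>)))"
        by (rule mult.left_commute)
      also have "\<dots> = f m \<omega>
          + W \<omega> * (\<Sum>j<k. exp (real m * k) * exp (- real m * j) * of_bool (N \<omega> = j))"
        by (subst split) (simp only: f_def distrib_left)
      also have "W \<omega> * (\<Sum>j<k. exp (real m * k) * exp (- real m * j) * of_bool (N \<omega> = j))
          = (\<Sum>j<k. exp (real m * k) * exp (- real m * j) * (W \<omega> * of_bool (N \<omega> = j)))"
        unfolding sum_distrib_left by (intro sum.cong refl mult.left_commute)
      finally show ?thesis .
    qed
    have int_f: "integrable M (f m)"
      unfolding f_def by (intro int) auto
    have int_j: "integrable M (\<lambda>\<omega>. W \<omega> * of_bool (N \<omega> = j))" for j
      by (intro int) auto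
    have "0 = expectation (\<lambda>\<omega>. exp (real m * k) * (W \<omega> * exp (- real m * real (N \<omega>))))"
      using zero[of "real m"] by simp
    also have "\<dots> = expectation (f m)
        + (\<Sum>j<k. exp (real m * k) * exp (- real m * j) * expectation (\<lambda>\<omega>. W \<omega> * of_bool (N \<omega> = j)))"
      unfolding eq using int_f int_j by simp
    also have "\<dots> = expectation (f m)"
      using less.IH by simp
    finally show ?thesis by simp
  qed
  have "(\<lambda>m. expectation (f m)) \<longlonglongrightarrow> expectation (\<lambda>\<omega>. W \<omega> * of_bool (N \<omega> = k))"
  proof (rule integral_dominated_convergence[where w="\<lambda>_. c"])
    show "AE \<omega> in M. (\<lambda>m. f m \<omega>) \<longlonglongrightarrow> W \<omega> * of_bool (N \<omega> = k)"
    proof (rule AE_I2)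
      fix \<omega>
      show "(\<lambda>m. f m \<omega>) \<longlonglongrightarrow> W \<omega> * of_bool (N \<omega> = k)"
      proof (cases "k < N \<omega>")
        case True
        have "(\<lambda>m. exp (- real (N \<omega> - k)) ^ m) \<longlonglongrightarrow> 0"
          by (rule LIMSEQ_power_zero) (use True in simp)
        then have "(\<lambda>m. W \<omega> * exp (- real (N \<omega> - k)) ^ m) \<longlonglongrightarrow> W \<omega> * 0"
          by (intro tendsto_mult tendsto_const)
        then show ?thesis
          using True by (simp add: f_def exp_of_nat_mult[symmetric] algebra_simps)
      qed (auto simp: f_def)
    qed
    show "AE \<omega> in M. norm (f m \<omega>) \<le> c" for m
      unfolding f_def using c by (intro AE_I2) (auto intro!: bW)
  qed auto
  then have "(\<lambda>m::nat. 0::real) \<longlonglongrightarrow> expectation (\<lambda>\<omega>. W \<omega> * of_bool (N \<omega> = k))"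
    by (simp add: f_zero)
  then show ?case
    using LIMSEQ_unique tendsto_const by blast
qed

text \<open>
  The exponential factors are turned into indicators one by one; those not yet treated are absorbed into
  the bounded weight.
\<close>

lemma (in prob_space) expectation_eq_zero_of_counts:
  fixes W :: "'a \<Rightarrow> real" and N :: "'i \<Rightarrow> 'a \<Rightarrow> nat"
  assumes "finite I" "W \<in> borel_measurable M" "\<And>i. i \<in> I \<Longrightarrow> N i \<in> measurable M (count_space UNIV)"
    and "\<And>\<omega>. \<bar>W \<omega>\<bar> \<le> c"
    and "\<And>t. (\<And>i. i \<in> I \<Longrightarrow> t i \<ge> 0) \<Longrightarrow>
      expectation (\<lambda>\<omega>. W \<omega> * (\<Prod>i\<in>I. exp (- t i * real (N i \<omega>)))) = 0"
  shows "expectation (\<lambda>\<omega>. W \<omega> * of_bool (\<forall>i\<in>I. N i \<omega> = k i)) = 0"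
  using assms
proof (induction I arbitrary: W rule: finite_induct)
  case (insert i I)
  note [measurable] = insert.prems(1)
  have [measurable]: "N j \<in> measurable M (count_space UNIV)" if "j \<in> insert i I" for j
    by (rule insert.prems) fact
  have c: "c \<ge> 0"
    using insert.prems(3)[of undefined] by linarith
  have bW: "\<bar>W \<omega> * x\<bar> \<le> c" if "\<bar>x\<bar> \<le> 1" for \<omega> x
    using mult_mono[OF insert.prems(3) that] c by (simp add: abs_mult)
  have "expectation (\<lambda>\<omega>. (W \<omega> * of_bool (N i \<omega> = k i)) * of_bool (\<forall>j\<in>I. N j \<omega> = k j)) = 0"
  proof (rule insert.IH)
    fix t :: "'i \<Rightarrow> real" assume t: "\<And>j. j \<in> I \<Longrightarrow> t j \<ge> 0"
    have "expectation (\<lambda>\<omega>. (W \<omega> * (\<Prod>j\<in>I. exp (- t j * real (N j \<omega>)))) * of_bool (N i \<omega> = k i)) = 0"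
    proof (rule expectation_eq_zero_of_count)
      have "\<bar>\<Prod>j\<in>I. exp (- t j * real (N j \<omega>))\<bar> \<le> 1" for \<omega>
        unfolding abs_prod using t by (intro prod_le_1) simp
      then show "\<bar>W \<omega> * (\<Prod>j\<in>I. exp (- t j * real (N j \<omega>)))\<bar> \<le> c" for \<omega>
        by (rule bW)
      fix s :: real assume s: "s \<ge> 0"
      have "expectation (\<lambda>\<omega>. W \<omega> * (\<Prod>j\<in>insert i I. exp (- (t(i := s)) j * real (N j \<omega>)))) = 0"
        using s t by (intro insert.prems) auto
      also have "(\<lambda>\<omega>. \<Prod>j\<in>insert i I. exp (- (t(i := s)) j * real (N j \<omega>)))
          = (\<lambda>\<omega>. exp (- s * real (N i \<omega>)) * (\<Prod>j\<in>I. exp (- t j * real (N j \<omega>))))"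
        using insert.hyps by (auto simp: fun_eq_iff intro!: prod.cong)
      finally show "expectation (\<lambda>\<omega>. W \<omega> * (\<Prod>j\<in>I. exp (- t j * real (N j \<omega>)))
          * exp (- s * real (N i \<omega>))) = 0"
        by (simp add: fun_eq_iff mult_ac)
    qed measurable
    then show "expectation (\<lambda>\<omega>. (W \<omega> * of_bool (N i \<omega> = k i)) * (\<Prod>j\<in>I. exp (- t j * real (N j \<omega>)))) = 0"
      by (simp add: mult_ac)
  qed (use insert.prems(3) c in auto)
  also have "(\<lambda>\<omega>. (W \<omega> * of_bool (N i \<omega> = k i)) * of_bool (\<forall>j\<in>I. N j \<omega> = k j))
      = (\<lambda>\<omega>. W \<omega> * of_bool (\<forall>j\<in>insert i I. N j \<omega> = k j))"
    by (auto simp: fun_eq_iff)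
  finally show ?case .
qed simp

text \<open>
  Taking the centred transform of the second family as weight for the first gives the factorisation for
  the indicators of the first; taking these, centred, as weight for the second completes it.
\<close>

lemma (in prob_space) prob_counts_eq_mult:
  fixes N :: "'i \<Rightarrow> 'a \<Rightarrow> nat" and L :: "'j \<Rightarrow> 'a \<Rightarrow> nat"
  assumes I: "finite I" and J: "finite J"
    and N: "\<And>i. i \<in> I \<Longrightarrow> N i \<in> measurable M (count_space UNIV)"
    and L: "\<And>j. j \<in> J \<Longrightarrow> L j \<in> measurable M (count_space UNIV)"
    and mult: "\<And>t s. (\<And>i. i \<in> I \<Longrightarrow> t i \<ge> 0) \<Longrightarrow> (\<And>j. j \<in> J \<Longrightarrow> s j \<ge> 0) \<Longrightarrow>
      expectation (\<lambda>\<omega>. (\<Prod>i\<in>I. exp (- t i * real (N i \<omega>))) * (\<Prod>j\<in>J. exp (- s j * real (L j \<omega>))))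
      = expectation (\<lambda>\<omega>. \<Prod>i\<in>I. exp (- t i * real (N i \<omega>)))
        * expectation (\<lambda>\<omega>. \<Prod>j\<in>J. exp (- s j * real (L j \<omega>)))"
  shows "prob {\<omega>\<in>space M. (\<forall>i\<in>I. N i \<omega> = k i) \<and> (\<forall>j\<in>J. L j \<omega> = l j)}
    = prob {\<omega>\<in>space M. \<forall>i\<in>I. N i \<omega> = k i} * prob {\<omega>\<in>space M. \<forall>j\<in>J. L j \<omega> = l j}"
proof -
  note [measurable] = N L
  let ?U = "\<lambda>t \<omega>. \<Prod>i\<in>I. exp (- t i * real (N i \<omega>))"
  let ?V = "\<lambda>s \<omega>. \<Prod>j\<in>J. exp (- s j * real (L j \<omega>))"
  let ?u = "\<lambda>\<omega>. of_bool (\<forall>i\<in>I. N i \<omega> = k i) :: real"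
  let ?v = "\<lambda>\<omega>. of_bool (\<forall>j\<in>J. L j \<omega> = l j) :: real"
  have fin [measurable]: "Measurable.pred M (\<lambda>\<omega>. \<forall>i\<in>I. N i \<omega> = k i)"
      "Measurable.pred M (\<lambda>\<omega>. \<forall>j\<in>J. L j \<omega> = l j)"
    using I J by (auto intro!: pred_intros_finite)
  have U: "0 \<le> ?U t \<omega>" "?U t \<omega> \<le> 1" if "\<And>i. i \<in> I \<Longrightarrow> t i \<ge> 0" for t \<omega>
    using that by (auto intro!: prod_nonneg prod_le_1)
  have V: "0 \<le> ?V s \<omega>" "?V s \<omega> \<le> 1" if "\<And>j. j \<in> J \<Longrightarrow> s j \<ge> 0" for s \<omega>
    using that by (auto intro!: prod_nonneg prod_le_1)
  have int: "integrable M g" if "g \<in> borel_measurable M" "\<And>\<omega>. 0 \<le> g \<omega>" "\<And>\<omega>. g \<omega> \<le> 1"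
    for g :: "'a \<Rightarrow> real"
    using that by (intro integrable_const_bound[of _ 1] AE_I2) auto
  have E01: "0 \<le> expectation g" "expectation g \<le> 1"
    if "g \<in> borel_measurable M" "\<And>\<omega>. 0 \<le> g \<omega>" "\<And>\<omega>. g \<omega> \<le> 1" for g :: "'a \<Rightarrow> real"
    using that int[OF that] integral_mono[of M g "\<lambda>_. 1"] by (auto simp: prob_space)
  have diff: "\<bar>a - b\<bar> \<le> 1" if "0 \<le> a" "a \<le> 1" "0 \<le> b" "b \<le> 1" for a b :: real
    using that by auto
  have step1: "expectation (\<lambda>\<omega>. (?V s \<omega> - expectation (?V s)) * ?u \<omega>) = 0"
    if s: "\<And>j. j \<in> J \<Longrightarrow> s j \<ge> 0" for s
  proof (rule expectation_eq_zero_of_counts[where c=1])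
    show "\<bar>?V s \<omega> - expectation (?V s)\<bar> \<le> 1" for \<omega>
      using V[OF s] by (intro diff E01) auto
    fix t :: "'i \<Rightarrow> real" assume t: "\<And>i. i \<in> I \<Longrightarrow> t i \<ge> 0"
    have "integrable M (\<lambda>\<omega>. ?U t \<omega> * ?V s \<omega>)"
      using U[OF t] V[OF s] by (intro int) (auto intro: mult_le_one)
    moreover have "integrable M (?U t)"
      using U[OF t] by (intro int) auto
    ultimately have "expectation (\<lambda>\<omega>. ?U t \<omega> * ?V s \<omega> - expectation (?V s) * ?U t \<omega>)
        = expectation (\<lambda>\<omega>. ?U t \<omega> * ?V s \<omega>) - expectation (?V s) * expectation (?U t)"
      by (simp only: Bochner_Integration.integral_diff integrable_mult_right integral_mult_right_zero)
    also have "\<dots> = 0"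
      using mult[OF t s] by simp
    finally have "expectation (\<lambda>\<omega>. ?U t \<omega> * ?V s \<omega> - expectation (?V s) * ?U t \<omega>) = 0" .
    then show "expectation (\<lambda>\<omega>. (?V s \<omega> - expectation (?V s)) * ?U t \<omega>) = 0"
      by (simp add: algebra_simps)
  qed (use I in auto)
  have "expectation (\<lambda>\<omega>. (?u \<omega> - expectation ?u) * ?v \<omega>) = 0"
  proof (rule expectation_eq_zero_of_counts[where c=1])
    show "\<bar>?u \<omega> - expectation ?u\<bar> \<le> 1" for \<omega>
      by (intro diff E01) auto
    fix s :: "'j \<Rightarrow> real" assume s: "\<And>j. j \<in> J \<Longrightarrow> s j \<ge> 0"
    have iV: "integrable M (?V s)"
      using V[OF s] by (intro int) auto
    have iuV: "integrable M (\<lambda>\<omega>. ?u \<omega> * ?V s \<omega>)"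
      using V[OF s] by (intro int) (auto intro: mult_le_one)
    have iu: "integrable M ?u"
      by (intro int) auto
    have "expectation (\<lambda>\<omega>. ?u \<omega> * ?V s \<omega> - expectation (?V s) * ?u \<omega>) = 0"
      using step1[OF s] by (simp add: algebra_simps)
    then have "expectation (\<lambda>\<omega>. ?u \<omega> * ?V s \<omega>) = expectation (?V s) * expectation ?u"
      using iuV iu by simp
    then have "expectation (\<lambda>\<omega>. ?u \<omega> * ?V s \<omega> - expectation ?u * ?V s \<omega>) = 0"
      using iuV iV by simp
    then show "expectation (\<lambda>\<omega>. (?u \<omega> - expectation ?u) * ?V s \<omega>) = 0"
      by (simp add: algebra_simps)
  qed (use J in auto)
  moreover have "integrable M (\<lambda>\<omega>. ?u \<omega> * ?v \<omega>)" "integrable M ?v"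
    by (intro int; auto)+
  ultimately have "expectation (\<lambda>\<omega>. ?u \<omega> * ?v \<omega>) = expectation ?u * expectation ?v"
    by (simp add: left_diff_distrib)
  moreover have "expectation (\<lambda>\<omega>. of_bool (P \<omega>) :: real) = prob {\<omega>\<in>space M. P \<omega>}"
    if "Measurable.pred M P" for P
  proof -
    have "expectation (\<lambda>\<omega>. of_bool (P \<omega>) :: real) = expectation (indicator {\<omega>\<in>space M. P \<omega>})"
      by (intro Bochner_Integration.integral_cong) (auto split: split_indicator)
    then show ?thesis
      using that by simp
  qed
  ultimately show ?thesis
    by (simp add: of_bool_conj[symmetric] fin)
qed

section \<open>Mixing coefficients by coupling\<close>

text \<open>
  Both laws give the same mass to the part of each cell outside \<open>H\<close>, and the parts inside \<open>H\<close> sum to at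
  most the probability of \<open>H\<close> for each of them.
\<close>

lemma (in prob_space) sum_abs_diff_distr_le:
  assumes [measurable]: "Z \<in> measurable M S" "Z' \<in> measurable M S" "H \<in> sets M"
    and eq: "\<And>\<omega>. \<omega> \<in> space M - H \<Longrightarrow> Z \<omega> = Z' \<omega>"
    and P: "finite P" "P \<subseteq> sets S" "disjoint P"
  shows "(\<Sum>E\<in>P. \<bar>measure (distr M S Z) E - measure (distr M S Z') E\<bar>) \<le> 2 * prob H"
proof -
  have part: "(\<Sum>E\<in>P. prob (Y -` E \<inter> H)) \<le> prob H" if [measurable]: "Y \<in> measurable M S" for Y
  proof -
    have sets: "Y -` E \<inter> H \<in> events" if "E \<in> P" for E
    proof -
      have "Y -` E \<inter> space M \<inter> H \<in> events"
        using that P by (intro sets.Int measurable_sets[of Y M S]) auto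
      moreover have "Y -` E \<inter> space M \<inter> H = Y -` E \<inter> H"
        using sets.sets_into_space[of H M] by auto
      ultimately show ?thesis by simp
    qed
    have "(\<Sum>E\<in>P. prob (Y -` E \<inter> H)) = prob (\<Union>E\<in>P. Y -` E \<inter> H)"
      using P sets
      by (intro finite_measure_finite_Union[symmetric])
        (auto simp: disjoint_family_on_def dest: disjointD)
    also have "\<dots> \<le> prob H"
      by (intro finite_measure_mono) auto
    finally show ?thesis .
  qed
  have "(\<Sum>E\<in>P. \<bar>measure (distr M S Z) E - measure (distr M S Z') E\<bar>)
      \<le> (\<Sum>E\<in>P. prob (Z -` E \<inter> H) + prob (Z' -` E \<inter> H))"
  proof (rule sum_mono)
    fix E assume "E \<in> P"
    then have [measurable]: "E \<in> sets S"
      using P by auto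
    have split: "prob (Y -` E \<inter> space M) = prob (Y -` E \<inter> H) + prob (Y -` E \<inter> (space M - H))"
      if [measurable]: "Y \<in> measurable M S" for Y
    proof -
      have "Y -` E \<inter> space M = (Y -` E \<inter> space M \<inter> H) \<union> (Y -` E \<inter> space M \<inter> (space M - H))"
        using sets.sets_into_space[of H M] by auto
      also have "prob \<dots> = prob (Y -` E \<inter> space M \<inter> H) + prob (Y -` E \<inter> space M \<inter> (space M - H))"
        by (intro finite_measure_Union) auto
      also have "Y -` E \<inter> space M \<inter> H = Y -` E \<inter> H"
        using sets.sets_into_space[of H M] by auto
      also have "Y -` E \<inter> space M \<inter> (space M - H) = Y -` E \<inter> (space M - H)"
        by auto
      finally show ?thesis .
    qed
    have "Z -` E \<inter> (space M - H) = Z' -` E \<inter> (space M - H)"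
      using eq by auto
    then show "\<bar>measure (distr M S Z) E - measure (distr M S Z') E\<bar>
        \<le> prob (Z -` E \<inter> H) + prob (Z' -` E \<inter> H)"
      by (simp add: measure_distr split abs_le_iff)
  qed
  also have "\<dots> \<le> 2 * prob H"
    using part[of Z] part[of Z'] by (simp add: sum.distrib)
  finally show ?thesis .
qed

text \<open>
  The joint law is coupled with the law of the independent pair \<open>(Y, Z)\<close> on \<open>M\<close> itself, the product of
  the marginal laws on \<open>M \<Otimes>\<^sub>M M\<close>.  Each coupling fails with probability at most the sum of those of the
  two exceptional events and costs twice that in total variation.
\<close>

lemma (in prob_space) beta_mixing_le_of_coupling:
  fixes \<Xi> :: "'a \<Rightarrow> 'b::euclidean_space measure"
  assumes \<Xi> [measurable]: "\<Xi> \<in> measurable M config_algebra"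
    and AB [measurable]: "A \<in> sets borel" "B \<in> sets borel"
    and YZ [measurable]: "Y \<in> measurable M config_algebra" "Z \<in> measurable M config_algebra"
    and indep: "\<And>U V. U \<in> sets config_algebra \<Longrightarrow> V \<in> sets config_algebra \<Longrightarrow>
      prob ((Y -` U \<inter> space M) \<inter> (Z -` V \<inter> space M)) = prob (Y -` U \<inter> space M) * prob (Z -` V \<inter> space M)"
    and H [measurable]: "H1 \<in> events" "H2 \<in> events"
    and Y: "\<And>\<omega>. \<omega> \<in> space M - H1 \<Longrightarrow> restrict_config A (\<Xi> \<omega>) = Y \<omega>"
    and Z: "\<And>\<omega>. \<omega> \<in> space M - H2 \<Longrightarrow> restrict_config B (\<Xi> \<omega>) = Z \<omega>"
  shows "beta_mixing M \<Xi> A B \<le> ennreal (2 * (prob H1 + prob H2))"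
proof -
  let ?C = "config_algebra :: 'b measure measure"
  let ?A = "\<lambda>\<omega>. restrict_config A (\<Xi> \<omega>)" and ?B = "\<lambda>\<omega>. restrict_config B (\<Xi> \<omega>)"
  let ?J = "distr M (?C \<Otimes>\<^sub>M ?C) (\<lambda>\<omega>. (?A \<omega>, ?B \<omega>))"
  let ?J' = "distr M (?C \<Otimes>\<^sub>M ?C) (\<lambda>\<omega>. (Y \<omega>, Z \<omega>))"
  let ?P = "distr M ?C ?A \<Otimes>\<^sub>M distr M ?C ?B"
  have A_m [measurable]: "?A \<in> measurable M ?C" and B_m [measurable]: "?B \<in> measurable M ?C"
    by (rule measurable_compose[OF \<Xi> measurable_restrict_config], fact)+
  have sf: "sigma_finite_measure (distr M ?C f)" if "f \<in> measurable M ?C" for f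
    using prob_space_distr[OF that] by (simp add: prob_space_imp_sigma_finite)
  have J': "?J' = distr M ?C Y \<Otimes>\<^sub>M distr M ?C Z"
  proof (rule pair_measure_eqI[symmetric])
    fix U V assume "U \<in> sets (distr M ?C Y)" "V \<in> sets (distr M ?C Z)"
    then have UV [measurable]: "U \<in> sets ?C" "V \<in> sets ?C"
      by auto
    have "(\<lambda>\<omega>. (Y \<omega>, Z \<omega>)) -` (U \<times> V) \<inter> space M = (Y -` U \<inter> space M) \<inter> (Z -` V \<inter> space M)"
      by auto
    then show "emeasure (distr M ?C Y) U * emeasure (distr M ?C Z) V = emeasure ?J' (U \<times> V)"
      using indep[OF UV] by (simp add: emeasure_distr emeasure_eq_measure ennreal_mult)
  qed (auto intro!: sf)
  \<comment> \<open>Product laws are laws of pairs of independent copies, so they can be coupled as well.\<close>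
  interpret MM: pair_prob_space M M ..
  have P: "?P = distr (M \<Otimes>\<^sub>M M) (?C \<Otimes>\<^sub>M ?C) (\<lambda>z. (?A (fst z), ?B (snd z)))"
    by (subst pair_measure_distr) (auto intro!: sf simp: case_prod_beta')
  have P': "?J' = distr (M \<Otimes>\<^sub>M M) (?C \<Otimes>\<^sub>M ?C) (\<lambda>z. (Y (fst z), Z (snd z)))"
    unfolding J' by (subst pair_measure_distr) (auto intro!: sf simp: case_prod_beta')
  let ?H = "H1 \<times> space M \<union> space M \<times> H2"
  have H_le: "MM.prob ?H \<le> prob H1 + prob H2"
  proof -
    have "MM.prob ?H \<le> MM.prob (H1 \<times> space M) + MM.prob (space M \<times> H2)"
      by (rule measure_Un_le) auto
    also have "\<dots> = prob H1 + prob H2"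
      by (simp add: measure_def emeasure_pair_measure_Times emeasure_space_1)
    finally show ?thesis .
  qed
  have "(\<Sum>E\<in>F. ennreal \<bar>measure ?J E - measure ?P E\<bar>) \<le> ennreal (4 * (prob H1 + prob H2))"
    if F: "finite F" "F \<subseteq> sets ?J" "disjoint F" for F
  proof -
    have F': "F \<subseteq> sets (?C \<Otimes>\<^sub>M ?C)"
      using F(2) by simp
    have "(\<Sum>E\<in>F. \<bar>measure ?J E - measure ?P E\<bar>)
        \<le> (\<Sum>E\<in>F. \<bar>measure ?J E - measure ?J' E\<bar> + \<bar>measure ?P E - measure ?J' E\<bar>)"
      by (intro sum_mono) linarith
    also have "\<dots> = (\<Sum>E\<in>F. \<bar>measure ?J E - measure ?J' E\<bar>) + (\<Sum>E\<in>F. \<bar>measure ?P E - measure ?J' E\<bar>)"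
      by (rule sum.distrib)
    also have "(\<Sum>E\<in>F. \<bar>measure ?J E - measure ?J' E\<bar>) \<le> 2 * prob (H1 \<union> H2)"
      using Y Z by (intro sum_abs_diff_distr_le F F') auto
    also have "prob (H1 \<union> H2) \<le> prob H1 + prob H2"
      by (rule measure_Un_le) auto
    also have "(\<Sum>E\<in>F. \<bar>measure ?P E - measure ?J' E\<bar>) \<le> 2 * MM.prob ?H"
      unfolding P P'
    proof (intro MM.sum_abs_diff_distr_le F F')
      fix z assume "z \<in> space (M \<Otimes>\<^sub>M M) - ?H"
      then have "fst z \<in> space M - H1" "snd z \<in> space M - H2"
        by (auto simp: space_pair_measure)
      then show "(?A (fst z), ?B (snd z)) = (Y (fst z), Z (snd z))"
        by (simp only: Y Z)
    qed auto
    also note H_le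
    finally have "(\<Sum>E\<in>F. \<bar>measure ?J E - measure ?P E\<bar>) \<le> 4 * (prob H1 + prob H2)"
      by simp
    then show ?thesis
      by (subst sum_ennreal) (simp_all only: ennreal_leI abs_ge_zero)
  qed
  then have "total_variation ?J ?P \<le> ennreal (4 * (prob H1 + prob H2))"
    unfolding total_variation_def by (intro SUP_least) blast
  then have "beta_mixing M \<Xi> A B \<le> ennreal (4 * (prob H1 + prob H2)) / 2"
    unfolding beta_mixing_def by (rule divide_right_mono_ennreal)
  also have "\<dots> = ennreal (2 * (prob H1 + prob H2))"
    using divide_ennreal[of "4 * (prob H1 + prob H2)" 2] by (simp del: ennreal_plus)
  finally show ?thesis .
qed

text \<open>
  The restriction to the empty set is constant, hence independent of everything.
\<close>

lemma (in prob_space) beta_mixing_empty: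
  fixes \<Xi> :: "'a \<Rightarrow> 'b::euclidean_space measure"
  assumes \<Xi>: "\<Xi> \<in> measurable M config_algebra" and AB: "A \<in> sets borel" "B \<in> sets borel"
    and empty: "A = {} \<or> B = {}"
  shows "beta_mixing M \<Xi> A B = 0"
proof -
  have const: "restrict_config {} (\<Xi> \<omega>) = null_measure borel" if "\<omega> \<in> space M" for \<omega>
  proof (rule measure_eqI)
    have sets: "sets (\<Xi> \<omega>) = sets borel"
      using measurable_space[OF \<Xi> that] by (rule sets_config)
    then show "sets (restrict_config {} (\<Xi> \<omega>)) = sets (null_measure borel)"
      by simp
    fix C assume "C \<in> sets (restrict_config {} (\<Xi> \<omega>))"
    then show "emeasure (restrict_config {} (\<Xi> \<omega>)) C = emeasure (null_measure borel) C"
      using sets by (simp add: emeasure_restrict_config)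
  qed
  have event: "(\<lambda>\<omega>. restrict_config {} (\<Xi> \<omega>)) -` U \<inter> space M = {} \<or>
      (\<lambda>\<omega>. restrict_config {} (\<Xi> \<omega>)) -` U \<inter> space M = space M" for U
    using const by auto
  have "beta_mixing M \<Xi> A B \<le> ennreal (2 * (prob {} + prob {}))"
  proof (rule beta_mixing_le_of_coupling[OF \<Xi> AB])
    show "(\<lambda>\<omega>. restrict_config A (\<Xi> \<omega>)) \<in> measurable M config_algebra"
      "(\<lambda>\<omega>. restrict_config B (\<Xi> \<omega>)) \<in> measurable M config_algebra"
      using \<Xi> AB by (auto intro: measurable_compose measurable_restrict_config)
    fix U V :: "'b measure set"
    have sub: "C -` W \<inter> space M \<subseteq> space M" for C W
      by blast
    show "prob (((\<lambda>\<omega>. restrict_config A (\<Xi> \<omega>)) -` U \<inter> space M) \<inter> ((\<lambda>\<omega>. restrict_config B (\<Xi> \<omega>)) -` V \<inter> space M))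
        = prob ((\<lambda>\<omega>. restrict_config A (\<Xi> \<omega>)) -` U \<inter> space M) * prob ((\<lambda>\<omega>. restrict_config B (\<Xi> \<omega>)) -` V \<inter> space M)"
      using empty
    proof
      assume "A = {}"
      then show ?thesis
        using event[of U] by (elim disjE) (simp_all add: prob_space Int_absorb1)
    next
      assume "B = {}"
      then show ?thesis
        using event[of V] by (elim disjE) (simp_all add: prob_space Int_absorb2)
    qed
  qed auto
  then show ?thesis
    by simp
qed

section \<open>Products over germs and grains\<close>

context germ_grain_model
begin

definition germs_in :: "'a set \<Rightarrow> 'w \<Rightarrow> nat set" where
  "germs_in K \<omega> = {n. X n \<omega> \<in> K}"

lemmas measurable_germ [measurable] = germ_measurable

lemma measurable_grain [measurable]: "G n \<in> measurable M config_algebra"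
  using grain_point_process by (simp add: point_process_def)

lemma measurable_germ_process [measurable]: "\<Phi> \<in> measurable M config_algebra"
  using germs_stationary by (simp add: stationary_process_def point_process_def)

lemma pred_finite_germs_in [measurable]:
  assumes [measurable]: "K \<in> sets borel"
  shows "Measurable.pred M (\<lambda>\<omega>. finite (germs_in K \<omega>))"
proof -
  have "finite (germs_in K \<omega>) \<longleftrightarrow> (\<exists>m. \<forall>n. X n \<omega> \<in> K \<longrightarrow> n < m)" for \<omega>
    by (auto simp: finite_nat_iff_bounded germs_in_def subset_eq)
  then show ?thesis
    by simp
qed

text \<open>
  A configuration has finitely many points in a bounded set, so almost surely only finitely many germs
  lie there, and products over them make sense.
\<close>

lemma AE_emeasure_germ_process:
  assumes K: "K \<in> sets borel" "bounded K"
  shows "AE \<omega> in M. finite (germs_in K \<omega>) \<and> emeasure (\<Phi> \<omega>) K = of_nat (card (germs_in K \<omega>))"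
proof (rule AE_mp[OF germs_eq], rule AE_I2, rule impI)
  fix \<omega> assume \<omega>: "\<omega> \<in> space M" and eq: "\<Phi> \<omega> = superpose (\<lambda>n. return borel (X n \<omega>))"
  have "emeasure (\<Phi> \<omega>) K = (\<Sum>n. indicator K (X n \<omega>))"
    using K by (simp add: eq emeasure_superpose)
  also have "\<dots> = (\<integral>\<^sup>+n. indicator (germs_in K \<omega>) n \<partial>count_space UNIV)"
    by (simp add: nn_integral_count_space_nat germs_in_def indicator_def)
  also have "\<dots> = emeasure (count_space UNIV) (germs_in K \<omega>)"
    by (intro nn_integral_indicator) simp
  finally have e: "emeasure (\<Phi> \<omega>) K = emeasure (count_space UNIV) (germs_in K \<omega>)" .
  have "emeasure (\<Phi> \<omega>) K < \<infinity>"
    using measurable_space[OF measurable_germ_process \<omega>] K by (rule config_bounded_finite)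
  then have "finite (germs_in K \<omega>)"
    unfolding e by (simp add: emeasure_count_space split: if_splits)
  then show "finite (germs_in K \<omega>) \<and> emeasure (\<Phi> \<omega>) K = of_nat (card (germs_in K \<omega>))"
    unfolding e by (simp add: emeasure_count_space)
qed

lemma AE_finite_germs_in:
  "K \<in> sets borel \<Longrightarrow> bounded K \<Longrightarrow> AE \<omega> in M. finite (germs_in K \<omega>)"
  using AE_emeasure_germ_process by (rule AE_mp) auto

lemma tendsto_prod_germs_in:
  fixes g :: "nat \<Rightarrow> real"
  assumes "finite (germs_in K \<omega>)"
  shows "(\<lambda>m. \<Prod>n<m. if X n \<omega> \<in> K then g n else 1) \<longlonglongrightarrow> (\<Prod>n\<in>germs_in K \<omega>. g n)"
proof -
  from assms obtain m where m: "germs_in K \<omega> \<subseteq> {..<m}"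
    by (auto simp: finite_nat_iff_bounded)
  have "(\<Prod>n<m'. if X n \<omega> \<in> K then g n else 1) = (\<Prod>n\<in>germs_in K \<omega>. g n)" if "m' \<ge> m" for m'
    using m that by (intro prod.mono_neutral_cong_right) (auto simp: germs_in_def)
  then have "eventually (\<lambda>m'. (\<Prod>n\<in>germs_in K \<omega>. g n) = (\<Prod>n<m'. if X n \<omega> \<in> K then g n else 1)) sequentially"
    by (intro eventually_sequentiallyI[of m]) simp
  then show ?thesis
    by (rule Lim_transform_eventually[OF tendsto_const])
qed

lemma measurable_prod_germs_in [measurable]:
  fixes g :: "nat \<Rightarrow> 'w \<Rightarrow> real"
  assumes [measurable]: "K \<in> sets borel" "\<And>n. g n \<in> borel_measurable M"
  shows "(\<lambda>\<omega>. \<Prod>n\<in>germs_in K \<omega>. g n \<omega>) \<in> borel_measurable M"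
proof -
  have "(\<lambda>\<omega>. if finite (germs_in K \<omega>)
      then lim (\<lambda>m. \<Prod>n<m. if X n \<omega> \<in> K then g n \<omega> else 1) else 1) \<in> borel_measurable M"
    by measurable
  also have "(\<lambda>\<omega>. if finite (germs_in K \<omega>)
      then lim (\<lambda>m. \<Prod>n<m. if X n \<omega> \<in> K then g n \<omega> else 1) else 1)
      = (\<lambda>\<omega>. \<Prod>n\<in>germs_in K \<omega>. g n \<omega>)"
    using limI[OF tendsto_prod_germs_in] by (auto simp: fun_eq_iff)
  finally show ?thesis .
qed

text \<open>
  Obtained from products over germs by taking every factor equal to \<open>exp 1\<close>.
\<close>

lemma measurable_card_germs_in [measurable]:
  assumes [measurable]: "K \<in> sets borel"
  shows "(\<lambda>\<omega>. card (germs_in K \<omega>)) \<in> measurable M (count_space UNIV)"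
proof -
  have "(\<lambda>\<omega>. nat \<lfloor>ln (\<Prod>n\<in>germs_in K \<omega>. exp 1 :: real)\<rfloor>) \<in> measurable M (count_space UNIV)"
    by measurable
  then show ?thesis
    by (simp add: exp_of_nat_mult[symmetric])
qed

lemma measurable_germs [measurable]: "(\<lambda>\<omega> n. X n \<omega>) \<in> measurable M (Pi\<^sub>M UNIV (\<lambda>_. borel))"
  by (intro measurable_PiM_single') auto

lemma measurable_grains [measurable]:
  "(\<lambda>\<omega> n. G n \<omega>) \<in> measurable M (Pi\<^sub>M UNIV (\<lambda>_. config_algebra))"
  using measurable_space[OF measurable_grain] by (intro measurable_PiM_single') auto

lemma distr_germs_grains:
  "distr M (Pi\<^sub>M UNIV (\<lambda>_. borel)) (\<lambda>\<omega> n. X n \<omega>)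
      \<Otimes>\<^sub>M distr M (Pi\<^sub>M UNIV (\<lambda>_. config_algebra)) (\<lambda>\<omega> n. G n \<omega>)
    = distr M (Pi\<^sub>M UNIV (\<lambda>_. borel) \<Otimes>\<^sub>M Pi\<^sub>M UNIV (\<lambda>_. config_algebra))
        (\<lambda>\<omega>. (\<lambda>n. X n \<omega>, \<lambda>n. G n \<omega>))"
    (is "distr M ?S ?X \<Otimes>\<^sub>M distr M ?T ?G = ?J")
proof (rule pair_measure_eqI)
  interpret PX: prob_space "distr M ?S ?X" by (rule prob_space_distr) measurable
  interpret PG: prob_space "distr M ?T ?G" by (rule prob_space_distr) measurable
  show "sigma_finite_measure (distr M ?S ?X)" "sigma_finite_measure (distr M ?T ?G)"
    by unfold_locales
  fix A B assume "A \<in> sets (distr M ?S ?X)" "B \<in> sets (distr M ?T ?G)"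
  then have [measurable]: "A \<in> sets ?S" "B \<in> sets ?T"
    by auto
  have "prob ((?X -` A \<inter> space M) \<inter> (?G -` B \<inter> space M))
      = prob (?X -` A \<inter> space M) * prob (?G -` B \<inter> space M)"
    using \<open>A \<in> sets ?S\<close> \<open>B \<in> sets ?T\<close> by (intro indep_setD[OF germs_grains_indep]) blast+
  moreover have "(\<lambda>\<omega>. (?X \<omega>, ?G \<omega>)) -` (A \<times> B) \<inter> space M = (?X -` A \<inter> space M) \<inter> (?G -` B \<inter> space M)"
    by auto
  ultimately show "emeasure (distr M ?S ?X) A * emeasure (distr M ?T ?G) B = emeasure ?J (A \<times> B)"
    by (simp add: emeasure_distr emeasure_eq_measure ennreal_mult)
qed simp

lemma expectation_grain_eq:
  assumes [measurable]: "f \<in> borel_measurable config_algebra"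
  shows "expectation (\<lambda>\<omega>. f (G n \<omega>)) = (expectation (\<lambda>\<omega>. f (G 0 \<omega>)) :: real)"
  using grains_ident_distr[of n 0] by (metis assms integral_distr measurable_grain)

text \<open>
  Conditionally on the germs, which are independent of the grains, the marks are independent and can be
  averaged separately.
\<close>

lemma expectation_prod_marks:
  fixes b :: "'a \<times> 'a measure \<Rightarrow> real"
  assumes b [measurable]: "b \<in> borel_measurable (borel \<Otimes>\<^sub>M config_algebra)"
    and b01: "\<And>z. 0 \<le> b z" "\<And>z. b z \<le> 1"
  shows "expectation (\<lambda>\<omega>. \<Prod>n<m. b (X n \<omega>, G n \<omega>))
    = expectation (\<lambda>\<omega>. \<Prod>n<m. expectation (\<lambda>\<omega>'. b (X n \<omega>, G 0 \<omega>')))"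
proof -
  let ?S = "Pi\<^sub>M UNIV (\<lambda>_. borel) :: (nat \<Rightarrow> 'a) measure"
  let ?T = "Pi\<^sub>M UNIV (\<lambda>_. config_algebra) :: (nat \<Rightarrow> 'a measure) measure"
  interpret PX: prob_space "distr M ?S (\<lambda>\<omega> n. X n \<omega>)" by (rule prob_space_distr) measurable
  interpret PG: prob_space "distr M ?T (\<lambda>\<omega> n. G n \<omega>)" by (rule prob_space_distr) measurable
  interpret P: pair_prob_space "distr M ?S (\<lambda>\<omega> n. X n \<omega>)" "distr M ?T (\<lambda>\<omega> n. G n \<omega>)" ..
  define f where "f z = (\<Prod>n<m. b (fst z n, snd z n))" for z :: "(nat \<Rightarrow> 'a) \<times> (nat \<Rightarrow> 'a measure)"
  have f [measurable]: "f \<in> borel_measurable (?S \<Otimes>\<^sub>M ?T)"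
    unfolding f_def by measurable
  have f01: "0 \<le> f z" "f z \<le> 1" for z
    unfolding f_def using b01 by (auto intro!: prod_nonneg prod_le_1)
  have inner: "expectation (\<lambda>\<omega>. f (x, \<lambda>n. G n \<omega>)) = (\<Prod>n<m. expectation (\<lambda>\<omega>. b (x n, G 0 \<omega>)))"
    for x :: "nat \<Rightarrow> 'a"
  proof -
    have [measurable]: "(\<lambda>\<mu>. b (y, \<mu>)) \<in> borel_measurable config_algebra" for y
      by measurable
    have "indep_vars (\<lambda>_. borel) (\<lambda>n \<omega>. b (x n, G n \<omega>)) {..<m}"
      by (rule indep_vars_compose2[OF indep_vars_subset[OF grains_indep]]) auto
    then have "expectation (\<lambda>\<omega>. \<Prod>n<m. b (x n, G n \<omega>)) = (\<Prod>n<m. expectation (\<lambda>\<omega>. b (x n, G n \<omega>)))"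
      using b01 by (intro indep_vars_lebesgue_integral) (auto intro!: integrable_const_bound[of _ 1])
    also have "\<dots> = (\<Prod>n<m. expectation (\<lambda>\<omega>. b (x n, G 0 \<omega>)))"
      by (intro prod.cong refl expectation_grain_eq) measurable
    finally show ?thesis by (simp add: f_def)
  qed
  have "expectation (\<lambda>\<omega>. \<Prod>n<m. b (X n \<omega>, G n \<omega>))
      = (\<integral>z. f z \<partial>distr M (?S \<Otimes>\<^sub>M ?T) (\<lambda>\<omega>. (\<lambda>n. X n \<omega>, \<lambda>n. G n \<omega>)))"
    by (subst integral_distr) (auto simp: f_def)
  also have "\<dots> = (\<integral>x. (\<integral>g. f (x, g) \<partial>distr M ?T (\<lambda>\<omega> n. G n \<omega>)) \<partial>distr M ?S (\<lambda>\<omega> n. X n \<omega>))"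
    unfolding distr_germs_grains[symmetric] using f01
    by (intro P.integral_fst'[symmetric] P.integrable_const_bound[of _ 1]) auto
  also have "\<dots> = (\<integral>x. (\<Prod>n<m. expectation (\<lambda>\<omega>. b (x n, G 0 \<omega>))) \<partial>distr M ?S (\<lambda>\<omega> n. X n \<omega>))"
    by (intro Bochner_Integration.integral_cong refl) (subst integral_distr; simp add: inner)
  also have "\<dots> = expectation (\<lambda>\<omega>. \<Prod>n<m. expectation (\<lambda>\<omega>'. b (X n \<omega>, G 0 \<omega>')))"
    by (subst integral_distr) auto
  finally show ?thesis .
qed

text \<open>
  The index set of the product is random; letting the marks of germs outside \<open>K\<close> be \<open>1\<close> reduces it to
  products over initial segments of the enumeration, which are eventually constant.
\<close>

lemma expectation_prod_germs_in:
  fixes a :: "'a \<times> 'a measure \<Rightarrow> real"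
  assumes a [measurable]: "a \<in> borel_measurable (borel \<Otimes>\<^sub>M config_algebra)"
    and a01: "\<And>z. 0 \<le> a z" "\<And>z. a z \<le> 1"
    and K: "K \<in> sets borel" "bounded K"
  shows "expectation (\<lambda>\<omega>. \<Prod>n\<in>germs_in K \<omega>. a (X n \<omega>, G n \<omega>))
    = expectation (\<lambda>\<omega>. \<Prod>n\<in>germs_in K \<omega>. expectation (\<lambda>\<omega>'. a (X n \<omega>, G 0 \<omega>')))"
proof -
  note [measurable] = K(1)
  define b where "b z = (if fst z \<in> K then a z else 1)" for z :: "'a \<times> 'a measure"
  have b [measurable]: "b \<in> borel_measurable (borel \<Otimes>\<^sub>M config_algebra)"
    unfolding b_def by measurable
  have b01: "0 \<le> b z" "b z \<le> 1" for z
    using a01 by (auto simp: b_def)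
  have L01: "0 \<le> expectation (\<lambda>\<omega>. c (x, G 0 \<omega>))" "expectation (\<lambda>\<omega>. c (x, G 0 \<omega>)) \<le> 1"
    if "c \<in> borel_measurable (borel \<Otimes>\<^sub>M config_algebra)" "\<And>z. 0 \<le> c z" "\<And>z. c z \<le> 1"
    for x and c :: "'a \<times> 'a measure \<Rightarrow> real"
    using that integral_mono[of M "\<lambda>\<omega>. c (x, G 0 \<omega>)" "\<lambda>_. 1"]
      integrable_const_bound[of "\<lambda>\<omega>. c (x, G 0 \<omega>)" 1]
    by (auto simp: prob_space)
  have Lb: "expectation (\<lambda>\<omega>. b (x, G 0 \<omega>))
      = (if x \<in> K then expectation (\<lambda>\<omega>. a (x, G 0 \<omega>)) else 1)" for x
    by (simp add: b_def prob_space)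
  have Lm [measurable]: "(\<lambda>x. expectation (\<lambda>\<omega>. a (x, G 0 \<omega>))) \<in> borel_measurable borel"
    by measurable
  have Lbm [measurable]: "(\<lambda>x. expectation (\<lambda>\<omega>. b (x, G 0 \<omega>))) \<in> borel_measurable borel"
    by measurable
  note fin = AE_finite_germs_in[OF K]
  have "(\<lambda>m. expectation (\<lambda>\<omega>. \<Prod>n<m. b (X n \<omega>, G n \<omega>)))
      \<longlonglongrightarrow> expectation (\<lambda>\<omega>. \<Prod>n\<in>germs_in K \<omega>. a (X n \<omega>, G n \<omega>))"
  proof (rule integral_dominated_convergence[where w="\<lambda>_. 1"])
    show "AE \<omega> in M. (\<lambda>m. \<Prod>n<m. b (X n \<omega>, G n \<omega>)) \<longlonglongrightarrow> (\<Prod>n\<in>germs_in K \<omega>. a (X n \<omega>, G n \<omega>))"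
      using fin by (rule AE_mp) (auto simp: b_def intro!: AE_I2 tendsto_prod_germs_in)
    show "AE \<omega> in M. norm (\<Prod>n<m. b (X n \<omega>, G n \<omega>)) \<le> 1" for m
      using b01 by (intro AE_I2) (auto simp: abs_prod intro!: prod_le_1)
  qed auto
  moreover have "(\<lambda>m. expectation (\<lambda>\<omega>. \<Prod>n<m. expectation (\<lambda>\<omega>'. b (X n \<omega>, G 0 \<omega>'))))
      \<longlonglongrightarrow> expectation (\<lambda>\<omega>. \<Prod>n\<in>germs_in K \<omega>. expectation (\<lambda>\<omega>'. a (X n \<omega>, G 0 \<omega>')))"
  proof (rule integral_dominated_convergence[where w="\<lambda>_. 1"])
    show "AE \<omega> in M. (\<lambda>m. \<Prod>n<m. expectation (\<lambda>\<omega>'. b (X n \<omega>, G 0 \<omega>')))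
        \<longlonglongrightarrow> (\<Prod>n\<in>germs_in K \<omega>. expectation (\<lambda>\<omega>'. a (X n \<omega>, G 0 \<omega>')))"
      unfolding Lb using fin by (rule AE_mp) (auto intro!: AE_I2 tendsto_prod_germs_in)
    show "AE \<omega> in M. norm (\<Prod>n<m. expectation (\<lambda>\<omega>'. b (X n \<omega>, G 0 \<omega>'))) \<le> 1" for m
      using L01[OF b b01] by (intro AE_I2) (auto simp: abs_prod intro!: prod_le_1)
  qed auto
  ultimately show ?thesis
    unfolding expectation_prod_marks[OF b b01] by (rule LIMSEQ_unique)
qed

end

section \<open>Complete independence of the Poisson germs\<close>

context boolean_model
begin

lemma germ_counts_indep:
  fixes C :: "'i \<Rightarrow> 'b set" and g :: "'i \<Rightarrow> nat \<Rightarrow> real"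
  assumes J: "finite J" "disjoint_family_on C J"
    and C: "\<And>j. j \<in> J \<Longrightarrow> C j \<in> sets borel" "\<And>j. j \<in> J \<Longrightarrow> bounded (C j)"
    and g: "\<And>j k. 0 \<le> g j k" "\<And>j k. g j k \<le> 1" "\<And>j. g j 0 = 1"
  shows "expectation (\<lambda>\<omega>. \<Prod>j\<in>J. g j (card (germs_in (C j) \<omega>)))
    = (\<Prod>j\<in>J. expectation (\<lambda>\<omega>. g j (card (germs_in (C j) \<omega>))))"
proof -
  \<comment> \<open>The index sets of the independence hypothesis are families of sets, so the empty sets, which
    may be repeated, are left out.\<close>
  define J' where "J' = {j\<in>J. C j \<noteq> {}}"
  have J': "finite J'" "J' \<subseteq> J"
    using J by (auto simp: J'_def)
  define h where "h j e = g j (nat \<lfloor>enn2real e\<rfloor>)" for j e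
  have h [measurable]: "h j \<in> borel_measurable borel" for j
    unfolding h_def by measurable
  have inj: "inj_on C J'"
  proof (rule inj_onI)
    fix i j assume "i \<in> J'" "j \<in> J'" "C i = C j"
    then show "i = j"
      using disjoint_family_onD[OF J(2), of i j] by (auto simp: J'_def)
  qed
  have disj: "disjoint (C ` J')"
  proof (rule disjointI)
    fix a b assume "a \<in> C ` J'" "b \<in> C ` J'" "a \<noteq> b"
    then show "a \<inter> b = {}"
      using disjoint_family_onD[OF J(2)] J'(2) by blast
  qed
  have "indep_vars (\<lambda>_. borel) (\<lambda>B \<omega>. emeasure (\<Phi> \<omega>) B) (C ` J')"
    using germs_poisson J' disj C unfolding poisson_process_def by blast
  then have "indep_vars (\<lambda>_. borel) (\<lambda>B \<omega>. h (inv_into J' C B) (emeasure (\<Phi> \<omega>) B)) (C ` J')"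
    by (rule indep_vars_compose2) measurable
  moreover have "integrable M (\<lambda>\<omega>. h i (emeasure (\<Phi> \<omega>) B))" if "B \<in> C ` J'" for B i
  proof (rule integrable_const_bound[of _ 1])
    have [measurable]: "B \<in> sets borel"
      using that C J' by blast
    show "(\<lambda>\<omega>. h i (emeasure (\<Phi> \<omega>) B)) \<in> borel_measurable M"
      by measurable
  qed (use g in \<open>simp add: h_def\<close>)
  ultimately have "expectation (\<lambda>\<omega>. \<Prod>B\<in>C ` J'. h (inv_into J' C B) (emeasure (\<Phi> \<omega>) B))
      = (\<Prod>B\<in>C ` J'. expectation (\<lambda>\<omega>. h (inv_into J' C B) (emeasure (\<Phi> \<omega>) B)))"
    using J' by (intro indep_vars_lebesgue_integral) auto
  then have indep: "expectation (\<lambda>\<omega>. \<Prod>j\<in>J'. h j (emeasure (\<Phi> \<omega>) (C j)))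
      = (\<Prod>j\<in>J'. expectation (\<lambda>\<omega>. h j (emeasure (\<Phi> \<omega>) (C j))))"
    by (simp add: prod.reindex[OF inj] inv_into_f_f[OF inj] cong: prod.cong)
  have AE_eq: "AE \<omega> in M. h j (emeasure (\<Phi> \<omega>) (C j)) = g j (card (germs_in (C j) \<omega>))"
    if "j \<in> J" for j
    using AE_emeasure_germ_process[OF C(1)[OF that] C(2)[OF that]]
    by (rule AE_mp) (simp add: h_def)
  have AE_all: "AE \<omega> in M. \<forall>j\<in>J. h j (emeasure (\<Phi> \<omega>) (C j)) = g j (card (germs_in (C j) \<omega>))"
    using J(1) AE_eq by (simp add: AE_finite_all)
  have meas: "(\<lambda>\<omega>. h j (emeasure (\<Phi> \<omega>) (C j))) \<in> borel_measurable M" if "j \<in> J" for j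
  proof -
    have [measurable]: "C j \<in> sets borel"
      using that C by blast
    show ?thesis by measurable
  qed
  have meas': "(\<lambda>\<omega>. g j (card (germs_in (C j) \<omega>))) \<in> borel_measurable M" if "j \<in> J" for j
  proof -
    have [measurable]: "C j \<in> sets borel"
      using that C by blast
    show ?thesis by measurable
  qed
  have one: "g j (card (germs_in (C j) \<omega>)) = 1" if "j \<in> J - J'" for j \<omega>
    using that g(3) by (auto simp: J'_def germs_in_def)
  have "expectation (\<lambda>\<omega>. \<Prod>j\<in>J. g j (card (germs_in (C j) \<omega>)))
      = expectation (\<lambda>\<omega>. \<Prod>j\<in>J'. h j (emeasure (\<Phi> \<omega>) (C j)))"
  proof (rule integral_cong_AE)
    show "AE \<omega> in M. (\<Prod>j\<in>J. g j (card (germs_in (C j) \<omega>))) = (\<Prod>j\<in>J'. h j (emeasure (\<Phi> \<omega>) (C j)))"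
      using AE_all
    proof (rule AE_mp, intro AE_I2 impI)
      fix \<omega> assume "\<forall>j\<in>J. h j (emeasure (\<Phi> \<omega>) (C j)) = g j (card (germs_in (C j) \<omega>))"
      then show "(\<Prod>j\<in>J. g j (card (germs_in (C j) \<omega>))) = (\<Prod>j\<in>J'. h j (emeasure (\<Phi> \<omega>) (C j)))"
        using J J' one by (intro prod.mono_neutral_cong_right) auto
    qed
  qed (use meas meas' J' in \<open>auto intro!: borel_measurable_prod\<close>)
  also have "\<dots> = (\<Prod>j\<in>J'. expectation (\<lambda>\<omega>. g j (card (germs_in (C j) \<omega>))))"
    unfolding indep using AE_eq meas meas' J' by (intro prod.cong refl integral_cong_AE) auto
  also have "\<dots> = (\<Prod>j\<in>J. expectation (\<lambda>\<omega>. g j (card (germs_in (C j) \<omega>))))"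
    using J J' one by (intro prod.mono_neutral_left) (auto simp: prob_space)
  finally show ?thesis .
qed

text \<open>
  The function \<open>L\<close> is approximated from below by functions with values in the multiples of
  \<open>1 / Suc m\<close>.  For these the products are functions of the numbers of germs in the level sets within
  \<open>K1\<close> and \<open>K2\<close>, to which complete independence applies.
\<close>

lemma expectation_prod_germs_in_disjoint:
  fixes L :: "'b \<Rightarrow> real"
  assumes L [measurable]: "L \<in> borel_measurable borel"
    and L01: "\<And>x. 0 \<le> L x" "\<And>x. L x \<le> 1"
    and K1: "K1 \<in> sets borel" "bounded K1" and K2: "K2 \<in> sets borel" "bounded K2"
    and disj: "K1 \<inter> K2 = {}"
  shows "expectation (\<lambda>\<omega>. (\<Prod>n\<in>germs_in K1 \<omega>. L (X n \<omega>)) * (\<Prod>n\<in>germs_in K2 \<omega>. L (X n \<omega>)))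
    = expectation (\<lambda>\<omega>. \<Prod>n\<in>germs_in K1 \<omega>. L (X n \<omega>))
      * expectation (\<lambda>\<omega>. \<Prod>n\<in>germs_in K2 \<omega>. L (X n \<omega>))"
proof -
  note [measurable] = K1(1) K2(1)
  define lv where "lv m x = nat \<lfloor>real (Suc m) * L x\<rfloor>" for m x
  define S where "S m x = real (lv m x) / real (Suc m)" for m x
  have lv_le: "lv m x \<le> Suc m" for m x
  proof -
    have "\<lfloor>real (Suc m) * L x\<rfloor> \<le> \<lfloor>real (Suc m) * 1\<rfloor>"
      by (intro floor_mono mult_left_mono L01) simp
    then show ?thesis
      by (simp only: lv_def nat_le_iff mult_1_right floor_of_nat)
  qed
  have S01: "0 \<le> S m x" "S m x \<le> 1" for m x
    using lv_le[of m x] by (auto simp: S_def divide_le_eq)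
  have lv_m [measurable]: "lv m \<in> measurable borel (count_space UNIV)" for m
    unfolding lv_def by measurable
  have S_m [measurable]: "S m \<in> borel_measurable borel" for m
    unfolding S_def by measurable
  have S_lim: "(\<lambda>m. S m x) \<longlonglongrightarrow> L x" for x
  proof (rule tendsto_sandwich)
    have fl: "real (lv m x) = of_int \<lfloor>real (Suc m) * L x\<rfloor>" for m
      using L01(1)[of x] by (simp add: lv_def)
    show "\<forall>\<^sub>F m in sequentially. L x - 1 / real (Suc m) \<le> S m x"
    proof (intro always_eventually allI)
      fix m
      have "real (Suc m) * L x - 1 \<le> real (lv m x)"
        unfolding fl by linarith
      then have "(real (Suc m) * L x - 1) / real (Suc m) \<le> S m x"
        unfolding S_def by (rule divide_right_mono) simp
      then show "L x - 1 / real (Suc m) \<le> S m x"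
        by (simp add: diff_divide_distrib del: of_nat_Suc)
    qed
    show "\<forall>\<^sub>F m in sequentially. S m x \<le> L x"
    proof (intro always_eventually allI)
      fix m
      have "real (lv m x) \<le> real (Suc m) * L x"
        unfolding fl by linarith
      then show "S m x \<le> L x"
        unfolding S_def by (simp add: field_simps)
    qed
    have "(\<lambda>m. 1 / real (Suc m)) \<longlonglongrightarrow> 0"
      using LIMSEQ_inverse_real_of_nat by (simp add: inverse_eq_divide)
    then show "(\<lambda>m. L x - 1 / real (Suc m)) \<longlonglongrightarrow> L x"
      using tendsto_diff[OF tendsto_const] by fastforce
  qed (rule tendsto_const)
  define C where "C m K j = {x\<in>K. lv m x = j}" for m K j
  have C: "C m K j \<in> sets borel" "bounded (C m K j)" if "K \<in> sets borel" "bounded K" for m K j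
  proof -
    have [measurable]: "K \<in> sets borel" by fact
    show "C m K j \<in> sets borel"
      unfolding C_def by measurable
    show "bounded (C m K j)"
      using that(2) by (rule bounded_subset) (auto simp: C_def)
  qed
  \<comment> \<open>The minimum is the value \<open>j / Suc m\<close> on every level \<open>j \<le> Suc m\<close>, and at most \<open>1\<close> for all \<open>j\<close>.\<close>
  define g :: "nat \<Rightarrow> nat \<Rightarrow> nat \<Rightarrow> real" where "g m j k = (min 1 (real j / real (Suc m))) ^ k" for m j k
  have g: "0 \<le> g m j k" "g m j k \<le> 1" "g m j 0 = 1" for m j k
    by (auto simp: g_def intro!: power_le_one)
  have prod_S: "(\<Prod>n\<in>germs_in K \<omega>. S m (X n \<omega>)) = (\<Prod>j\<le>Suc m. g m j (card (germs_in (C m K j) \<omega>)))"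
    if fin: "finite (germs_in K \<omega>)" for m K \<omega>
  proof -
    have "(\<Prod>n\<in>germs_in K \<omega>. S m (X n \<omega>))
        = (\<Prod>j\<le>Suc m. \<Prod>n\<in>{n\<in>germs_in K \<omega>. lv m (X n \<omega>) = j}. S m (X n \<omega>))"
      using fin lv_le by (intro prod.group[symmetric]) auto
    also have "\<dots> = (\<Prod>j\<le>Suc m. g m j (card (germs_in (C m K j) \<omega>)))"
    proof (intro prod.cong refl)
      fix j assume "j \<in> {..Suc m}"
      then have "min 1 (real j / real (Suc m)) = real j / real (Suc m)"
        by (intro min_absorb2) (simp add: divide_le_eq)
      moreover have "{n\<in>germs_in K \<omega>. lv m (X n \<omega>) = j} = germs_in (C m K j) \<omega>"
        by (auto simp: germs_in_def C_def)
      moreover have "(\<Prod>n\<in>{n\<in>germs_in K \<omega>. lv m (X n \<omega>) = j}. S m (X n \<omega>))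
          = (\<Prod>n\<in>{n\<in>germs_in K \<omega>. lv m (X n \<omega>) = j}. real j / real (Suc m))"
        by (intro prod.cong refl) (simp add: S_def)
      ultimately show "(\<Prod>n\<in>{n\<in>germs_in K \<omega>. lv m (X n \<omega>) = j}. S m (X n \<omega>))
          = g m j (card (germs_in (C m K j) \<omega>))"
        by (simp add: g_def)
    qed
    finally show ?thesis .
  qed
  let ?K = "\<lambda>b. if b then K1 else K2"
  note fin1 = AE_finite_germs_in[OF K1] and fin2 = AE_finite_germs_in[OF K2]
  have E_level: "expectation (\<lambda>\<omega>. \<Prod>n\<in>germs_in K \<omega>. S m (X n \<omega>))
      = (\<Prod>j\<le>Suc m. expectation (\<lambda>\<omega>. g m j (card (germs_in (C m K j) \<omega>))))"
    if K: "K \<in> sets borel" "bounded K" for K m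
  proof -
    have [measurable]: "K \<in> sets borel" by fact
    have "(\<integral>\<omega>. (\<Prod>n\<in>germs_in K \<omega>. S m (X n \<omega>)) \<partial>M)
        = (\<integral>\<omega>. (\<Prod>j\<le>Suc m. g m j (card (germs_in (C m K j) \<omega>))) \<partial>M)"
    proof (rule integral_cong_AE)
      show "AE \<omega> in M. (\<Prod>n\<in>germs_in K \<omega>. S m (X n \<omega>))
          = (\<Prod>j\<le>Suc m. g m j (card (germs_in (C m K j) \<omega>)))"
        using AE_finite_germs_in[OF K] by (rule AE_mp) (simp add: prod_S)
      have [measurable]: "C m K j \<in> sets borel" for j
        using C K by blast
      show "(\<lambda>\<omega>. \<Prod>n\<in>germs_in K \<omega>. S m (X n \<omega>)) \<in> borel_measurable M"
        "(\<lambda>\<omega>. \<Prod>j\<le>Suc m. g m j (card (germs_in (C m K j) \<omega>))) \<in> borel_measurable M"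
        by measurable
    qed
    also have "\<dots> = (\<Prod>j\<le>Suc m. expectation (\<lambda>\<omega>. g m j (card (germs_in (C m K j) \<omega>))))"
      using K C g by (intro germ_counts_indep) (auto simp: disjoint_family_on_def C_def)
    finally show ?thesis .
  qed
  \<comment> \<open>Complete independence is applied to the level sets in both regions together and, above, in each
    of them, so that no grouping of independent variables is needed.\<close>
  have E_level2: "expectation (\<lambda>\<omega>. (\<Prod>n\<in>germs_in K1 \<omega>. S m (X n \<omega>)) * (\<Prod>n\<in>germs_in K2 \<omega>. S m (X n \<omega>)))
      = expectation (\<lambda>\<omega>. \<Prod>n\<in>germs_in K1 \<omega>. S m (X n \<omega>))
        * expectation (\<lambda>\<omega>. \<Prod>n\<in>germs_in K2 \<omega>. S m (X n \<omega>))" for m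
  proof -
    let ?C = "\<lambda>(b, j). C m (?K b) j" and ?g = "\<lambda>(b, j). g m j" and ?J = "(UNIV :: bool set) \<times> {..Suc m}"
    have prod_bool: "(\<Prod>i\<in>?J. f i) = (\<Prod>j\<le>Suc m. f (True, j)) * (\<Prod>j\<le>Suc m. f (False, j))"
      for f :: "bool \<times> nat \<Rightarrow> real"
      using prod.cartesian_product[of "\<lambda>b j. f (b, j)" "{..Suc m}" UNIV]
      by (simp add: UNIV_bool mult.commute del: prod.atMost_Suc)
    have KK: "?K b \<in> sets borel" "bounded (?K b)" for b
      using K1 K2 by auto
    have "(\<integral>\<omega>. (\<Prod>n\<in>germs_in K1 \<omega>. S m (X n \<omega>)) * (\<Prod>n\<in>germs_in K2 \<omega>. S m (X n \<omega>)) \<partial>M)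
        = (\<integral>\<omega>. (\<Prod>i\<in>?J. ?g i (card (germs_in (?C i) \<omega>))) \<partial>M)"
    proof (rule integral_cong_AE)
      show "AE \<omega> in M. (\<Prod>n\<in>germs_in K1 \<omega>. S m (X n \<omega>)) * (\<Prod>n\<in>germs_in K2 \<omega>. S m (X n \<omega>))
          = (\<Prod>i\<in>?J. ?g i (card (germs_in (?C i) \<omega>)))"
        using fin1 fin2 by eventually_elim (simp only: prod_S prod_bool prod.case if_True if_False)
      have Cm [measurable]: "?C i \<in> sets borel" for i
        using C(1)[OF KK] by (cases i) (simp only: prod.case)
      show "(\<lambda>\<omega>. (\<Prod>n\<in>germs_in K1 \<omega>. S m (X n \<omega>)) * (\<Prod>n\<in>germs_in K2 \<omega>. S m (X n \<omega>))) \<in> borel_measurable M"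
        "(\<lambda>\<omega>. \<Prod>i\<in>?J. ?g i (card (germs_in (?C i) \<omega>))) \<in> borel_measurable M"
        by measurable
    qed
    also have "\<dots> = (\<Prod>i\<in>?J. expectation (\<lambda>\<omega>. ?g i (card (germs_in (?C i) \<omega>))))"
    proof (rule germ_counts_indep)
      show "disjoint_family_on ?C ?J"
        using disj by (auto simp: disjoint_family_on_def C_def split: if_splits)
    qed (use C[OF KK] g in auto)
    also have "\<dots> = expectation (\<lambda>\<omega>. \<Prod>n\<in>germs_in K1 \<omega>. S m (X n \<omega>))
        * expectation (\<lambda>\<omega>. \<Prod>n\<in>germs_in K2 \<omega>. S m (X n \<omega>))"
      by (simp only: prod_bool prod.case if_True if_False E_level[OF K1] E_level[OF K2])
    finally show ?thesis .
  qed
  have P01: "\<bar>\<Prod>n\<in>germs_in K \<omega>. S m (X n \<omega>)\<bar> \<le> 1" for K m \<omega>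
    using S01 by (auto simp: abs_prod intro!: prod_le_1)
  have lim: "(\<lambda>m. expectation (\<lambda>\<omega>. \<Prod>n\<in>germs_in K \<omega>. S m (X n \<omega>)))
      \<longlonglongrightarrow> expectation (\<lambda>\<omega>. \<Prod>n\<in>germs_in K \<omega>. L (X n \<omega>))"
    if [measurable]: "K \<in> sets borel" for K
    by (rule integral_dominated_convergence[where w="\<lambda>_. 1"])
      (use S_lim P01 in \<open>auto intro!: tendsto_prod\<close>)
  have "(\<lambda>m. expectation (\<lambda>\<omega>. (\<Prod>n\<in>germs_in K1 \<omega>. S m (X n \<omega>)) * (\<Prod>n\<in>germs_in K2 \<omega>. S m (X n \<omega>))))
      \<longlonglongrightarrow> expectation (\<lambda>\<omega>. (\<Prod>n\<in>germs_in K1 \<omega>. L (X n \<omega>)) * (\<Prod>n\<in>germs_in K2 \<omega>. L (X n \<omega>)))"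
    by (rule integral_dominated_convergence[where w="\<lambda>_. 1"])
      (use S_lim P01 in \<open>auto simp: abs_mult intro!: tendsto_prod tendsto_mult mult_le_one\<close>)
  moreover have "(\<lambda>m. expectation (\<lambda>\<omega>. \<Prod>n\<in>germs_in K1 \<omega>. S m (X n \<omega>))
        * expectation (\<lambda>\<omega>. \<Prod>n\<in>germs_in K2 \<omega>. S m (X n \<omega>)))
      \<longlonglongrightarrow> expectation (\<lambda>\<omega>. \<Prod>n\<in>germs_in K1 \<omega>. L (X n \<omega>))
        * expectation (\<lambda>\<omega>. \<Prod>n\<in>germs_in K2 \<omega>. L (X n \<omega>))"
    by (intro tendsto_mult lim K1 K2)
  ultimately show ?thesis
    unfolding E_level2 by (rule LIMSEQ_unique)
qed

text \<open>
  Averaging the marks leaves products that depend on the germs only; these factorise, and the averages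
  can be undone in each factor.
\<close>

lemma expectation_prod_marks_disjoint:
  fixes a :: "'b \<times> 'b measure \<Rightarrow> real"
  assumes a [measurable]: "a \<in> borel_measurable (borel \<Otimes>\<^sub>M config_algebra)"
    and a01: "\<And>z. 0 \<le> a z" "\<And>z. a z \<le> 1"
    and K1: "K1 \<in> sets borel" "bounded K1" and K2: "K2 \<in> sets borel" "bounded K2"
    and disj: "K1 \<inter> K2 = {}"
  shows "expectation (\<lambda>\<omega>. (\<Prod>n\<in>germs_in K1 \<omega>. a (X n \<omega>, G n \<omega>)) * (\<Prod>n\<in>germs_in K2 \<omega>. a (X n \<omega>, G n \<omega>)))
    = expectation (\<lambda>\<omega>. \<Prod>n\<in>germs_in K1 \<omega>. a (X n \<omega>, G n \<omega>))
      * expectation (\<lambda>\<omega>. \<Prod>n\<in>germs_in K2 \<omega>. a (X n \<omega>, G n \<omega>))"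
proof -
  note [measurable] = K1(1) K2(1)
  define L where "L x = expectation (\<lambda>\<omega>. a (x, G 0 \<omega>))" for x
  have Lm [measurable]: "L \<in> borel_measurable borel"
    unfolding L_def by measurable
  have int: "integrable M (\<lambda>\<omega>. a (x, G 0 \<omega>))" for x
    using a01 by (intro integrable_const_bound[of _ 1]) auto
  have L01: "0 \<le> L x" "L x \<le> 1" for x
    using a01 integral_mono[OF int, of "\<lambda>_. 1" x] by (auto simp: L_def prob_space)
  have K: "K1 \<union> K2 \<in> sets borel" "bounded (K1 \<union> K2)"
    using K1 K2 by auto
  note marks = expectation_prod_germs_in[OF a a01, folded L_def]
  have split: "AE \<omega> in M. (\<Prod>n\<in>germs_in (K1 \<union> K2) \<omega>. f n \<omega>)
      = (\<Prod>n\<in>germs_in K1 \<omega>. f n \<omega>) * (\<Prod>n\<in>germs_in K2 \<omega>. f n \<omega>)" for f :: "nat \<Rightarrow> 'a \<Rightarrow> real"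
    using AE_finite_germs_in[OF K1] AE_finite_germs_in[OF K2]
  proof eventually_elim
    fix \<omega> assume "finite (germs_in K1 \<omega>)" "finite (germs_in K2 \<omega>)"
    moreover have "germs_in (K1 \<union> K2) \<omega> = germs_in K1 \<omega> \<union> germs_in K2 \<omega>" "germs_in K1 \<omega> \<inter> germs_in K2 \<omega> = {}"
      using disj by (auto simp: germs_in_def)
    ultimately show "(\<Prod>n\<in>germs_in (K1 \<union> K2) \<omega>. f n \<omega>)
        = (\<Prod>n\<in>germs_in K1 \<omega>. f n \<omega>) * (\<Prod>n\<in>germs_in K2 \<omega>. f n \<omega>)"
      by (simp add: prod.union_disjoint)
  qed
  have E_split: "expectation (\<lambda>\<omega>. \<Prod>n\<in>germs_in (K1 \<union> K2) \<omega>. f n \<omega>)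
      = expectation (\<lambda>\<omega>. (\<Prod>n\<in>germs_in K1 \<omega>. f n \<omega>) * (\<Prod>n\<in>germs_in K2 \<omega>. f n \<omega>))"
    if [measurable]: "\<And>n. f n \<in> borel_measurable M" for f :: "nat \<Rightarrow> 'a \<Rightarrow> real"
  proof (rule integral_cong_AE)
    show "(\<lambda>\<omega>. \<Prod>n\<in>germs_in (K1 \<union> K2) \<omega>. f n \<omega>) \<in> borel_measurable M"
      "(\<lambda>\<omega>. (\<Prod>n\<in>germs_in K1 \<omega>. f n \<omega>) * (\<Prod>n\<in>germs_in K2 \<omega>. f n \<omega>)) \<in> borel_measurable M"
      by measurable
  qed (rule split)
  have "expectation (\<lambda>\<omega>. (\<Prod>n\<in>germs_in K1 \<omega>. a (X n \<omega>, G n \<omega>)) * (\<Prod>n\<in>germs_in K2 \<omega>. a (X n \<omega>, G n \<omega>)))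
      = expectation (\<lambda>\<omega>. \<Prod>n\<in>germs_in (K1 \<union> K2) \<omega>. a (X n \<omega>, G n \<omega>))"
    by (rule E_split[symmetric]) measurable
  also have "\<dots> = expectation (\<lambda>\<omega>. \<Prod>n\<in>germs_in (K1 \<union> K2) \<omega>. L (X n \<omega>))"
    by (rule marks[OF K])
  also have "\<dots> = expectation (\<lambda>\<omega>. (\<Prod>n\<in>germs_in K1 \<omega>. L (X n \<omega>)) * (\<Prod>n\<in>germs_in K2 \<omega>. L (X n \<omega>)))"
    by (rule E_split) measurable
  also have "\<dots> = expectation (\<lambda>\<omega>. \<Prod>n\<in>germs_in K1 \<omega>. L (X n \<omega>))
      * expectation (\<lambda>\<omega>. \<Prod>n\<in>germs_in K2 \<omega>. L (X n \<omega>))"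
    by (rule expectation_prod_germs_in_disjoint[OF Lm L01 K1 K2 disj])
  finally show ?thesis
    by (simp only: marks[OF K1] marks[OF K2])
qed

end

section \<open>The grains with germs in a bounded region\<close>

context germ_grain_model
begin

text \<open>
  On the null set where infinitely many germs lie in \<open>K\<close> the superposition need not be locally finite.
  It is replaced by the empty configuration there, so that the process takes values in the
  configurations everywhere.
\<close>

definition cluster_process :: "'a set \<Rightarrow> 'a set \<Rightarrow> 'w \<Rightarrow> 'a measure" where
  "cluster_process K A \<omega> =
    (if finite (germs_in K \<omega>)
     then superpose (\<lambda>n. if X n \<omega> \<in> K then restrict_config A (translate_config (X n \<omega>) (G n \<omega>))
       else null_measure borel)
     else null_measure borel)"

lemma sets_cluster_process [simp]: "sets (cluster_process K A \<omega>) = sets borel"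
  by (simp add: cluster_process_def)

lemma emeasure_cluster_process_suminf:
  assumes "A \<in> sets borel" "C \<in> sets borel"
  shows "emeasure (cluster_process K A \<omega>) C =
    (if finite (germs_in K \<omega>)
     then \<Sum>n. if X n \<omega> \<in> K then emeasure (translate_config (X n \<omega>) (G n \<omega>)) (A \<inter> C) else 0
     else 0)"
proof -
  have "emeasure (if b then restrict_config A (translate_config x \<mu>) else null_measure borel) C
      = (if b then emeasure (translate_config x \<mu>) (A \<inter> C) else 0)" for b x \<mu>
    using assms by (simp add: emeasure_restrict_config)
  then show ?thesis
    using assms by (simp add: cluster_process_def emeasure_superpose)
qed

lemma emeasure_cluster_process:
  assumes "A \<in> sets borel" "C \<in> sets borel" "finite (germs_in K \<omega>)"
  shows "emeasure (cluster_process K A \<omega>) C =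
    (\<Sum>n\<in>germs_in K \<omega>. emeasure (translate_config (X n \<omega>) (G n \<omega>)) (A \<inter> C))"
proof -
  have "(\<Sum>n. if X n \<omega> \<in> K then emeasure (translate_config (X n \<omega>) (G n \<omega>)) (A \<inter> C) else 0)
      = (\<Sum>n\<in>germs_in K \<omega>. if X n \<omega> \<in> K then emeasure (translate_config (X n \<omega>) (G n \<omega>)) (A \<inter> C) else 0)"
    using assms(3) by (intro suminf_finite) (auto simp: germs_in_def)
  also have "\<dots> = (\<Sum>n\<in>germs_in K \<omega>. emeasure (translate_config (X n \<omega>) (G n \<omega>)) (A \<inter> C))"
    by (intro sum.cong) (auto simp: germs_in_def)
  finally show ?thesis
    using assms by (simp add: emeasure_cluster_process_suminf)
qed

lemma measurable_emeasure_grain [measurable]: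
  assumes "C \<in> sets borel"
  shows "(\<lambda>\<omega>. emeasure (translate_config (X n \<omega>) (G n \<omega>)) C) \<in> borel_measurable M"
proof -
  have "(\<lambda>\<omega>. (X n \<omega>, G n \<omega>)) \<in> measurable M (borel \<Otimes>\<^sub>M config_algebra)"
    by measurable
  from measurable_compose[OF this measurable_emeasure_translate_config[OF assms]] show ?thesis
    by simp
qed

lemma emeasure_grain_Nats:
  assumes "\<omega> \<in> space M" "C \<in> sets borel" "bounded C"
  shows "emeasure (translate_config (X n \<omega>) (G n \<omega>)) C \<in> \<nat>"
  using measurable_space[OF measurable_grain assms(1)] assms(2,3)
  by (intro config_bounded_Nats translate_config_space)

lemma measurable_cluster_process [measurable]:
  assumes [measurable]: "K \<in> sets borel" "A \<in> sets borel"
  shows "cluster_process K A \<in> measurable M config_algebra"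
proof (rule measurable_config_algebraI)
  fix C :: "'a set" assume [measurable]: "C \<in> sets borel" and C: "bounded C"
  show "(\<lambda>\<omega>. emeasure (cluster_process K A \<omega>) C) \<in> borel_measurable M"
    by (simp add: emeasure_cluster_process_suminf)
  have "bounded (A \<inter> C)"
    using C by blast
  then show "emeasure (cluster_process K A \<omega>) C \<in> \<nat>" if "\<omega> \<in> space M" for \<omega>
    using emeasure_grain_Nats[OF that, of "A \<inter> C"]
    by (cases "finite (germs_in K \<omega>)")
      (simp_all add: emeasure_cluster_process sum_in_Nats, simp add: emeasure_cluster_process_suminf)
qed simp

lemma AE_eq_cluster_process:
  assumes K: "K \<in> sets borel" "bounded K" and A: "A \<in> sets borel"
  shows "AE \<omega> in M. (\<forall>n. X n \<omega> \<notin> K \<longrightarrow> emeasure (translate_config (X n \<omega>) (G n \<omega>)) A = 0)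
    \<longrightarrow> restrict_config A (\<Xi> \<omega>) = cluster_process K A \<omega>"
  using model_eq AE_finite_germs_in[OF K]
proof eventually_elim
  fix \<omega> assume eq: "\<Xi> \<omega> = superpose (\<lambda>n. translate_config (X n \<omega>) (G n \<omega>))"
    and fin: "finite (germs_in K \<omega>)"
  show "(\<forall>n. X n \<omega> \<notin> K \<longrightarrow> emeasure (translate_config (X n \<omega>) (G n \<omega>)) A = 0)
    \<longrightarrow> restrict_config A (\<Xi> \<omega>) = cluster_process K A \<omega>"
  proof
    assume zero: "\<forall>n. X n \<omega> \<notin> K \<longrightarrow> emeasure (translate_config (X n \<omega>) (G n \<omega>)) A = 0"
    show "restrict_config A (\<Xi> \<omega>) = cluster_process K A \<omega>"
    proof (rule measure_eqI)
      fix C assume "C \<in> sets (restrict_config A (\<Xi> \<omega>))"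
      then have C: "C \<in> sets borel"
        by (simp add: eq)
      have *: "emeasure (translate_config (X n \<omega>) (G n \<omega>)) (A \<inter> C) = 0" if "X n \<omega> \<notin> K" for n
        using zero that A by (metis Int_lower1 emeasure_mono le_zero_eq sets_translate_config)
      have "emeasure (restrict_config A (\<Xi> \<omega>)) C = (\<Sum>n. emeasure (translate_config (X n \<omega>) (G n \<omega>)) (A \<inter> C))"
        using A C by (simp add: eq emeasure_restrict_config emeasure_superpose)
      also have "\<dots> = (\<Sum>n. if X n \<omega> \<in> K then emeasure (translate_config (X n \<omega>) (G n \<omega>)) (A \<inter> C) else 0)"
        by (intro suminf_cong) (simp add: *)
      finally show "emeasure (restrict_config A (\<Xi> \<omega>)) C = emeasure (cluster_process K A \<omega>) C"
        using A C fin by (simp add: emeasure_cluster_process_suminf)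
    qed (simp add: eq)
  qed
qed

text \<open>
  The factor that the grain \<open>\<mu>\<close> of a germ at \<open>x\<close> contributes to the exponential moment of the numbers
  of points in the sets \<open>A \<inter> C i\<close>.
\<close>

definition cluster_weight :: "'a set \<Rightarrow> 'i set \<Rightarrow> ('i \<Rightarrow> 'a set) \<Rightarrow> ('i \<Rightarrow> real) \<Rightarrow> 'a \<times> 'a measure \<Rightarrow> real" where
  "cluster_weight A I C t z =
    exp (- (\<Sum>i\<in>I. t i * enn2real (emeasure (translate_config (fst z) (snd z)) (A \<inter> C i))))"

lemma measurable_cluster_weight:
  assumes [measurable]: "A \<in> sets borel" and C: "\<And>i. i \<in> I \<Longrightarrow> C i \<in> sets borel"
  shows "cluster_weight A I C t \<in> borel_measurable (borel \<Otimes>\<^sub>M config_algebra)"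
proof -
  have [measurable]: "(\<lambda>z. emeasure (translate_config (fst z) (snd z)) (A \<inter> C i))
      \<in> borel_measurable (borel \<Otimes>\<^sub>M config_algebra)" if "i \<in> I" for i
    using measurable_emeasure_translate_config[of "A \<inter> C i"] C[OF that] by (simp add: case_prod_beta')
  show ?thesis
    unfolding cluster_weight_def[abs_def] by measurable
qed

lemma cluster_weight_bounds:
  assumes "\<And>i. i \<in> I \<Longrightarrow> t i \<ge> 0"
  shows "0 \<le> cluster_weight A I C t z" "cluster_weight A I C t z \<le> 1"
  using assms by (auto simp: cluster_weight_def intro!: sum_nonneg)

lemma prod_exp_cluster_process:
  assumes A: "A \<in> sets borel" and C: "\<And>i. i \<in> I \<Longrightarrow> C i \<in> sets borel" "\<And>i. i \<in> I \<Longrightarrow> bounded (C i)"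
    and \<omega>: "\<omega> \<in> space M" and fin: "finite (germs_in K \<omega>)" and I: "finite I"
  shows "(\<Prod>i\<in>I. exp (- t i * real (nat \<lfloor>enn2real (emeasure (cluster_process K A \<omega>) (C i))\<rfloor>)))
    = (\<Prod>n\<in>germs_in K \<omega>. cluster_weight A I C t (X n \<omega>, G n \<omega>))"
proof -
  let ?e = "\<lambda>n i. emeasure (translate_config (X n \<omega>) (G n \<omega>)) (A \<inter> C i)"
  have nats: "?e n i \<in> \<nat>" if "i \<in> I" for n i
  proof -
    have "bounded (A \<inter> C i)"
      using C(2)[OF that] by blast
    then show ?thesis
      using A C(1)[OF that] by (intro emeasure_grain_Nats \<omega>) simp_all
  qed
  have real: "real (nat \<lfloor>enn2real (emeasure (cluster_process K A \<omega>) (C i))\<rfloor>)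
      = (\<Sum>n\<in>germs_in K \<omega>. enn2real (?e n i))" if i: "i \<in> I" for i
  proof -
    have e: "emeasure (cluster_process K A \<omega>) (C i) = (\<Sum>n\<in>germs_in K \<omega>. ?e n i)"
      using A C(1)[OF i] fin by (rule emeasure_cluster_process)
    have "(\<Sum>n\<in>germs_in K \<omega>. ?e n i) \<in> \<nat>"
      by (intro sum_in_Nats nats i)
    then obtain k where "(\<Sum>n\<in>germs_in K \<omega>. ?e n i) = of_nat k"
      by (auto elim: Nats_cases)
    then have "real (nat \<lfloor>enn2real (emeasure (cluster_process K A \<omega>) (C i))\<rfloor>)
        = enn2real (\<Sum>n\<in>germs_in K \<omega>. ?e n i)"
      by (simp add: e)
    also have "\<dots> = (\<Sum>n\<in>germs_in K \<omega>. enn2real (?e n i))"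
      using Nats_ennreal_less_top[OF nats[OF i]] by (subst enn2real_sum) auto
    finally show ?thesis .
  qed
  have "(\<Prod>i\<in>I. exp (- t i * real (nat \<lfloor>enn2real (emeasure (cluster_process K A \<omega>) (C i))\<rfloor>)))
      = (\<Prod>i\<in>I. exp (- t i * (\<Sum>n\<in>germs_in K \<omega>. enn2real (?e n i))))"
    by (intro prod.cong refl) (simp only: real)
  also have "\<dots> = exp (\<Sum>i\<in>I. \<Sum>n\<in>germs_in K \<omega>. - t i * enn2real (?e n i))"
    using I by (simp only: exp_sum sum_distrib_left)
  also have "\<dots> = exp (\<Sum>n\<in>germs_in K \<omega>. \<Sum>i\<in>I. - t i * enn2real (?e n i))"
    by (subst sum.swap) (rule refl)
  also have "\<dots> = (\<Prod>n\<in>germs_in K \<omega>. cluster_weight A I C t (X n \<omega>, G n \<omega>))"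
    unfolding cluster_weight_def exp_sum[OF fin] by (intro prod.cong refl) (simp add: sum_negf)
  finally show ?thesis .
qed

end

text \<open>
  It suffices to treat events that fix the numbers of points in finitely many sets, hence joint exponential
  moments.  They are expectations of products of a single mark function over the germs in \<open>K1\<close> and in
  \<open>K2\<close>: as the regions are disjoint, one function can act as the weight for \<open>A\<close> on \<open>K1\<close> and as that for
  \<open>B\<close> elsewhere.
\<close>

lemma (in boolean_model) indep_cluster_processes:
  assumes K1: "K1 \<in> sets borel" "bounded K1" and K2: "K2 \<in> sets borel" "bounded K2"
    and disj: "K1 \<inter> K2 = {}" and A: "A \<in> sets borel" and B: "B \<in> sets borel"
  shows "indep_var config_algebra (cluster_process K1 A) config_algebra (cluster_process K2 B)"
proof -
  note [measurable] = K1(1) K2(1) A B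
  let ?Y = "cluster_process K1 A" and ?Z = "cluster_process K2 B"
  let ?E = "\<lambda>Y S. {Y -` U \<inter> space M | U. U \<in> S}"
  let ?N = "\<lambda>Y (i :: 'b set \<times> nat) \<omega>. nat \<lfloor>enn2real (emeasure (Y \<omega>) (fst i))\<rfloor>"
  have event: "Y -` {\<mu> \<in> space config_algebra. \<forall>(C, k)\<in>S. emeasure \<mu> C = of_nat k} \<inter> space M
      = {\<omega>\<in>space M. \<forall>i\<in>S. ?N Y i \<omega> = snd i}"
    if Y: "Y \<in> measurable M config_algebra" and S: "\<forall>(C, k::nat)\<in>S. C \<in> sets borel \<and> bounded C" for Y S
  proof -
    have "emeasure (Y \<omega>) C = of_nat k \<longleftrightarrow> ?N Y (C, k) \<omega> = k" if "\<omega> \<in> space M" "(C, k) \<in> S" for \<omega> C k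
    proof -
      have "emeasure (Y \<omega>) C \<in> \<nat>"
        using measurable_space[OF Y that(1)] S that(2) by (auto intro: config_bounded_Nats)
      then show ?thesis
        by (auto elim!: Nats_cases)
    qed
    then show ?thesis
      using measurable_space[OF Y] by fastforce
  qed
  have indep: "indep_set (?E ?Y count_events) (?E ?Z count_events)"
    unfolding indep_sets2_eq
  proof (intro conjI ballI)
    have "?E Y count_events \<subseteq> events" if "Y \<in> measurable M config_algebra" for Y :: "'a \<Rightarrow> 'b measure"
      using measurable_sets[OF that] count_events_sets by blast
    then show "?E ?Y count_events \<subseteq> events" "?E ?Z count_events \<subseteq> events"
      by measurable
    fix a b assume "a \<in> ?E ?Y count_events" "b \<in> ?E ?Z count_events"
    then obtain S T where fin: "finite S" "finite T"
      and S: "\<forall>(C, k::nat)\<in>S. C \<in> sets borel \<and> bounded C"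
      and T: "\<forall>(C, k::nat)\<in>T. C \<in> sets borel \<and> bounded C"
      and a: "a = ?Y -` {\<mu> \<in> space config_algebra. \<forall>(C, k)\<in>S. emeasure \<mu> C = of_nat k} \<inter> space M"
      and b: "b = ?Z -` {\<mu> \<in> space config_algebra. \<forall>(C, k)\<in>T. emeasure \<mu> C = of_nat k} \<inter> space M"
      unfolding count_events_def by blast
    have a': "a = {\<omega>\<in>space M. \<forall>i\<in>S. ?N ?Y i \<omega> = snd i}"
      unfolding a by (rule event[OF _ S]) measurable
    have b': "b = {\<omega>\<in>space M. \<forall>i\<in>T. ?N ?Z i \<omega> = snd i}"
      unfolding b by (rule event[OF _ T]) measurable
    have ab: "a \<inter> b = {\<omega>\<in>space M. (\<forall>i\<in>S. ?N ?Y i \<omega> = snd i) \<and> (\<forall>i\<in>T. ?N ?Z i \<omega> = snd i)}"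
      unfolding a' b' by auto
    have S': "fst i \<in> sets borel" "bounded (fst i)" if "i \<in> S" for i
      using S that by auto
    have T': "fst i \<in> sets borel" "bounded (fst i)" if "i \<in> T" for i
      using T that by auto
    show "prob (a \<inter> b) = prob a * prob b"
      unfolding ab unfolding a' b'
    proof (rule prob_counts_eq_mult[OF fin])
      show meas1: "?N ?Y i \<in> measurable M (count_space UNIV)" if "i \<in> S" for i
      proof -
        have [measurable]: "fst i \<in> sets borel" using S'[OF that] by simp
        show ?thesis by measurable
      qed
      show meas2: "?N ?Z i \<in> measurable M (count_space UNIV)" if "i \<in> T" for i
      proof -
        have [measurable]: "fst i \<in> sets borel" using T'[OF that] by simp
        show ?thesis by measurable
      qed
      fix t s :: "'b set \<times> nat \<Rightarrow> real"
      assume t: "\<And>i. i \<in> S \<Longrightarrow> t i \<ge> 0" and s: "\<And>i. i \<in> T \<Longrightarrow> s i \<ge> 0"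
      let ?U = "\<lambda>\<omega>. \<Prod>i\<in>S. exp (- t i * real (?N ?Y i \<omega>))"
      let ?V = "\<lambda>\<omega>. \<Prod>i\<in>T. exp (- s i * real (?N ?Z i \<omega>))"
      have mU [measurable]: "?U \<in> borel_measurable M"
        using meas1 by measurable
      have mV [measurable]: "?V \<in> borel_measurable M"
        using meas2 by measurable
      define w where "w z = (if fst z \<in> K1 then cluster_weight A S fst t z else cluster_weight B T fst s z)" for z
      have [measurable]: "cluster_weight A S fst t \<in> borel_measurable (borel \<Otimes>\<^sub>M config_algebra)"
        "cluster_weight B T fst s \<in> borel_measurable (borel \<Otimes>\<^sub>M config_algebra)"
        using S' T' A B by (auto intro!: measurable_cluster_weight)
      have w: "w \<in> borel_measurable (borel \<Otimes>\<^sub>M config_algebra)"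
        unfolding w_def by measurable
      note [measurable] = w
      have w01: "0 \<le> w z" "w z \<le> 1" for z
        using cluster_weight_bounds[of S t] cluster_weight_bounds[of T s] t s by (auto simp: w_def)
      have U: "AE \<omega> in M. ?U \<omega> = (\<Prod>n\<in>germs_in K1 \<omega>. w (X n \<omega>, G n \<omega>))"
        using AE_space AE_finite_germs_in[OF K1]
      proof eventually_elim
        fix \<omega> assume "\<omega> \<in> space M" "finite (germs_in K1 \<omega>)"
        then have "?U \<omega> = (\<Prod>n\<in>germs_in K1 \<omega>. cluster_weight A S fst t (X n \<omega>, G n \<omega>))"
          using S' by (intro prod_exp_cluster_process A fin)
        then show "?U \<omega> = (\<Prod>n\<in>germs_in K1 \<omega>. w (X n \<omega>, G n \<omega>))"
          by (simp add: w_def germs_in_def)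
      qed
      have V: "AE \<omega> in M. ?V \<omega> = (\<Prod>n\<in>germs_in K2 \<omega>. w (X n \<omega>, G n \<omega>))"
        using AE_space AE_finite_germs_in[OF K2]
      proof eventually_elim
        fix \<omega> assume "\<omega> \<in> space M" "finite (germs_in K2 \<omega>)"
        then have "?V \<omega> = (\<Prod>n\<in>germs_in K2 \<omega>. cluster_weight B T fst s (X n \<omega>, G n \<omega>))"
          using T' by (intro prod_exp_cluster_process B fin)
        also have "\<dots> = (\<Prod>n\<in>germs_in K2 \<omega>. w (X n \<omega>, G n \<omega>))"
          using disj by (intro prod.cong) (auto simp: w_def germs_in_def)
        finally show "?V \<omega> = (\<Prod>n\<in>germs_in K2 \<omega>. w (X n \<omega>, G n \<omega>))" .
      qed
      have EU: "expectation ?U = expectation (\<lambda>\<omega>. \<Prod>n\<in>germs_in K1 \<omega>. w (X n \<omega>, G n \<omega>))"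
        by (rule integral_cong_AE[OF _ _ U]) measurable
      have EV: "expectation ?V = expectation (\<lambda>\<omega>. \<Prod>n\<in>germs_in K2 \<omega>. w (X n \<omega>, G n \<omega>))"
        by (rule integral_cong_AE[OF _ _ V]) measurable
      have "AE \<omega> in M. ?U \<omega> * ?V \<omega>
          = (\<Prod>n\<in>germs_in K1 \<omega>. w (X n \<omega>, G n \<omega>)) * (\<Prod>n\<in>germs_in K2 \<omega>. w (X n \<omega>, G n \<omega>))"
        using U V by eventually_elim simp
      then have "expectation (\<lambda>\<omega>. ?U \<omega> * ?V \<omega>) = expectation (\<lambda>\<omega>.
          (\<Prod>n\<in>germs_in K1 \<omega>. w (X n \<omega>, G n \<omega>)) * (\<Prod>n\<in>germs_in K2 \<omega>. w (X n \<omega>, G n \<omega>)))"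
        by (rule integral_cong_AE[rotated 2]) measurable
      also have "\<dots> = expectation ?U * expectation ?V"
        unfolding EU EV by (rule expectation_prod_marks_disjoint[OF w w01 K1 K2 disj])
      finally show "expectation (\<lambda>\<omega>. ?U \<omega> * ?V \<omega>) = expectation ?U * expectation ?V" .
    qed
  qed
  have Int: "Int_stable (?E Y count_events)" for Y :: "'a \<Rightarrow> 'b measure"
  proof (rule Int_stableI)
    fix a b assume "a \<in> ?E Y count_events" "b \<in> ?E Y count_events"
    then obtain U V where UV: "U \<in> count_events" "V \<in> count_events"
      and ab: "a = Y -` U \<inter> space M" "b = Y -` V \<inter> space M"
      by blast
    have "a \<inter> b = Y -` (U \<inter> V) \<inter> space M"
      unfolding ab by auto
    moreover have "U \<inter> V \<in> count_events"
      using UV Int_stable_count_events by (rule Int_stableD[rotated])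
    ultimately show "a \<inter> b \<in> ?E Y count_events"
      by blast
  qed
  from indep Int Int have "indep_set (sigma_sets (space M) (?E ?Y count_events)) (sigma_sets (space M) (?E ?Z count_events))"
    by (rule indep_set_sigma_sets)
  moreover have "sigma_sets (space M) (?E Y (sets config_algebra)) \<subseteq> sigma_sets (space M) (?E Y count_events)"
    if "Y \<in> measurable M config_algebra" for Y :: "'a \<Rightarrow> 'b measure"
  proof (rule sigma_sets_mono)
    have "Y \<in> space M \<rightarrow> space config_algebra"
      using measurable_space[OF that] by blast
    then have "?E Y (sigma_sets (space config_algebra) count_events) = sigma_sets (space M) (?E Y count_events)"
      by (rule sigma_sets_vimage_commute)
    then show "?E Y (sets config_algebra) \<subseteq> sigma_sets (space M) (?E Y count_events)"
      using sets_config_algebra_count_events by blast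
  qed
  ultimately have "indep_set (sigma_sets (space M) (?E ?Y (sets config_algebra)))
      (sigma_sets (space M) (?E ?Z (sets config_algebra)))"
    unfolding indep_set_def
    by (elim indep_sets_mono_sets) (auto split: bool.split)
  then show ?thesis
    unfolding indep_var_eq by simp
qed

section \<open>Intensity of the germs\<close>

lemma (in prob_space) nn_integral_poisson:
  fixes Z :: "'a \<Rightarrow> ennreal"
  assumes [measurable]: "Z \<in> borel_measurable M"
    and nat: "\<And>\<omega>. \<omega> \<in> space M \<Longrightarrow> Z \<omega> \<in> \<nat>"
    and poisson: "\<And>k::nat. prob {\<omega>\<in>space M. Z \<omega> = of_nat k} = c ^ k / fact k * exp (- c)"
    and c: "c \<ge> 0"
  shows "(\<integral>\<^sup>+\<omega>. Z \<omega> \<partial>M) = ennreal c"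
proof -
  have sets [measurable]: "{\<omega>\<in>space M. Z \<omega> = of_nat k} \<in> events" for k
    by measurable
  have "(\<integral>\<^sup>+\<omega>. Z \<omega> \<partial>M)
      = (\<integral>\<^sup>+\<omega>. (\<Sum>k. of_nat k * indicator {\<omega>\<in>space M. Z \<omega> = of_nat k} \<omega>) \<partial>M)"
  proof (rule nn_integral_cong)
    fix \<omega> assume \<omega>: "\<omega> \<in> space M"
    then obtain n where n: "Z \<omega> = of_nat n"
      using nat by (auto elim: Nats_cases)
    have "(\<Sum>k. of_nat k * indicator {\<omega>\<in>space M. Z \<omega> = of_nat k} \<omega>)
        = (\<Sum>k\<in>{n}. of_nat k * indicator {\<omega>\<in>space M. Z \<omega> = of_nat k} \<omega> :: ennreal)"
      by (rule suminf_finite) (auto simp: n)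
    then show "Z \<omega> = (\<Sum>k. of_nat k * indicator {\<omega>\<in>space M. Z \<omega> = of_nat k} \<omega>)"
      using \<omega> n by simp
  qed
  also have "\<dots> = (\<Sum>k. of_nat k * emeasure M {\<omega>\<in>space M. Z \<omega> = of_nat k})"
    by (subst nn_integral_suminf) (simp_all add: nn_integral_cmult sets)
  also have "\<dots> = (\<Sum>k. ennreal (real k * (c ^ k / fact k * exp (- c))))"
  proof (rule suminf_cong)
    fix k
    show "of_nat k * emeasure M {\<omega>\<in>space M. Z \<omega> = of_nat k}
        = ennreal (real k * (c ^ k / fact k * exp (- c)))"
      unfolding emeasure_eq_measure poisson
      using c by (simp add: ennreal_of_nat_eq_real_of_nat ennreal_mult[symmetric])
  qed
  also have "\<dots> = ennreal c"
  proof -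
    have "(\<lambda>k. c * exp (- c) * (c ^ k /\<^sub>R fact k)) sums (c * exp (- c) * exp c)"
      by (intro sums_mult exp_converges)
    then have "(\<lambda>k. real (Suc k) * (c ^ Suc k / fact (Suc k) * exp (- c))) sums c"
      by (simp add: field_simps exp_minus del: of_nat_Suc)
    then have "(\<lambda>k. real k * (c ^ k / fact k * exp (- c))) sums c"
      by (subst (asm) sums_Suc_iff) simp
    then show ?thesis
      using c by (intro suminf_ennreal_eq) auto
  qed
  finally show ?thesis .
qed

text \<open>
  Integrating the mass of \<open>ball y 1\<close> over all \<open>y\<close> counts every point with the volume of the unit ball, and
  points of \<open>cball a R\<close> are only seen from \<open>cball a (R + 1)\<close>.  This replaces a covering by translates of a
  fixed set.
\<close>

lemma emeasure_cball_le_of_ball: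
  fixes \<Lambda> :: "'a::euclidean_space measure"
  assumes sets [measurable_cong]: "sets \<Lambda> = sets borel"
    and fin: "\<And>r. emeasure \<Lambda> (cball 0 r) < \<infinity>"
    and unit: "\<And>y. emeasure \<Lambda> (ball y 1) \<le> m"
    and R: "R \<ge> 0"
  shows "emeasure \<Lambda> (cball a R) \<le> m * ennreal ((R + 1) ^ DIM('a))"
proof -
  let ?v = "ennreal (unit_ball_vol (real DIM('a)))"
  have "sigma_finite_measure \<Lambda>"
  proof
    have "(\<Union>k::nat. cball (0::'a) (real k)) = UNIV"
      by (simp add: set_eq_iff real_arch_simple)
    then show "\<exists>A. countable A \<and> A \<subseteq> sets \<Lambda> \<and> \<Union>A = space \<Lambda> \<and> (\<forall>a\<in>A. emeasure \<Lambda> a \<noteq> \<infinity>)"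
      using fin sets_eq_imp_space_eq[OF sets]
      by (intro exI[of _ "range (\<lambda>k::nat. cball 0 (real k))"]) (auto simp: sets less_top)
  qed
  then interpret \<Lambda>: sigma_finite_measure \<Lambda> .
  interpret pair_sigma_finite \<Lambda> lborel ..
  have v: "?v \<noteq> 0" "?v \<noteq> \<top>"
    by (simp_all add: unit_ball_vol_pos[THEN less_imp_neq, THEN not_sym] less_le_not_le[symmetric])
  \<comment> \<open>Both sides are multiplied by the volume \<open>?v\<close> of the unit ball.\<close>
  have "?v * emeasure \<Lambda> (cball a R)
      = (\<integral>\<^sup>+x. indicator (cball a R) x * emeasure lborel (ball x 1) \<partial>\<Lambda>)"
    by (simp add: emeasure_ball nn_integral_cmult_indicator mult.commute sets)
  also have "\<dots> = (\<integral>\<^sup>+x. (\<integral>\<^sup>+y. indicator (cball a R) x * indicator (ball x 1) y \<partial>lborel) \<partial>\<Lambda>)"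
    by (intro nn_integral_cong nn_integral_cmult_indicator[symmetric]) simp
  also have "\<dots> = (\<integral>\<^sup>+y. (\<integral>\<^sup>+x. indicator (cball a R) x * indicator (ball x 1) y \<partial>\<Lambda>) \<partial>lborel)"
  proof (rule Fubini'[symmetric])
    have "{z \<in> space (\<Lambda> \<Otimes>\<^sub>M lborel). dist a (fst z) \<le> R \<and> dist (fst z) (snd z) < 1}
        \<in> sets (\<Lambda> \<Otimes>\<^sub>M lborel)"
      by measurable
    then have "indicator {z \<in> space (\<Lambda> \<Otimes>\<^sub>M lborel). dist a (fst z) \<le> R \<and> dist (fst z) (snd z) < 1}
        \<in> borel_measurable (\<Lambda> \<Otimes>\<^sub>M lborel)"
      by (rule borel_measurable_indicator)
    then show "(\<lambda>(x, y). indicator (cball a R) x * indicator (ball x 1) y :: ennreal)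
        \<in> borel_measurable (\<Lambda> \<Otimes>\<^sub>M lborel)"
      by (rule measurable_cong[THEN iffD1, rotated])
        (auto simp: space_pair_measure sets_eq_imp_space_eq[OF sets] split: split_indicator)
  qed
  also have "\<dots> \<le> (\<integral>\<^sup>+y. indicator (cball a (R + 1)) y * m \<partial>lborel)"
  proof (rule nn_integral_mono)
    fix y :: 'a
    have "(\<integral>\<^sup>+x. indicator (cball a R) x * indicator (ball x 1) y \<partial>\<Lambda>)
        \<le> (\<integral>\<^sup>+x. indicator (cball a (R + 1)) y * indicator (ball y 1) x \<partial>\<Lambda>)"
    proof (rule nn_integral_mono)
      fix x
      have "dist a y \<le> dist a x + dist x y"
        by (rule dist_triangle)
      then show "indicator (cball a R) x * indicator (ball x 1) y
          \<le> (indicator (cball a (R + 1)) y * indicator (ball y 1) x :: ennreal)"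
        by (auto split: split_indicator simp: dist_commute)
    qed
    also have "\<dots> = indicator (cball a (R + 1)) y * emeasure \<Lambda> (ball y 1)"
      by (intro nn_integral_cmult_indicator) (simp add: sets)
    also have "\<dots> \<le> indicator (cball a (R + 1)) y * m"
      by (intro mult_left_mono unit) simp
    finally show "(\<integral>\<^sup>+x. indicator (cball a R) x * indicator (ball x 1) y \<partial>\<Lambda>)
        \<le> indicator (cball a (R + 1)) y * m" .
  qed
  also have "\<dots> = ?v * (m * ennreal ((R + 1) ^ DIM('a)))"
    using R by (simp add: nn_integral_cmult_indicator emeasure_cball ennreal_mult mult_ac)
  finally show ?thesis
    using v by (simp add: ennreal_mult_le_mult_iff)
qed

text \<open>
  The expected number of germs in a bounded set is the parameter of its Poisson law, which is finite, and
  by stationarity all unit balls have the same one.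
\<close>

lemma (in boolean_model) expected_germs_cball:
  obtains m where "m \<ge> 0"
    "\<And>a r. r \<ge> 0 \<Longrightarrow> (\<Sum>n. emeasure M {\<omega>\<in>space M. X n \<omega> \<in> cball a r}) \<le> ennreal (m * (r + 1) ^ DIM('b))"
proof -
  from germs_poisson have "\<exists>\<Lambda>. sets \<Lambda> = sets borel \<and>
      (\<forall>B\<in>sets borel. bounded B \<longrightarrow> emeasure \<Lambda> B < \<infinity> \<and>
        (\<forall>k::nat. prob {\<omega>\<in>space M. emeasure (\<Phi> \<omega>) B = of_nat k}
          = measure \<Lambda> B ^ k / fact k * exp (- measure \<Lambda> B)))"
    unfolding poisson_process_def by (elim conjE)
  then obtain \<Lambda> where \<Lambda>: "sets \<Lambda> = sets borel"
    and *: "\<forall>B\<in>sets borel. bounded B \<longrightarrow> emeasure \<Lambda> B < \<infinity> \<and>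
      (\<forall>k::nat. prob {\<omega>\<in>space M. emeasure (\<Phi> \<omega>) B = of_nat k}
        = measure \<Lambda> B ^ k / fact k * exp (- measure \<Lambda> B))"
    by (elim exE conjE) (rule that)
  have fin: "emeasure \<Lambda> B < \<infinity>" if "B \<in> sets borel" "bounded B" for B
    using *[rule_format, OF that] by (rule conjunct1)
  have poisson: "prob {\<omega>\<in>space M. emeasure (\<Phi> \<omega>) B = of_nat k}
      = measure \<Lambda> B ^ k / fact k * exp (- measure \<Lambda> B)" if "B \<in> sets borel" "bounded B" for B k
    using *[rule_format, OF that] by (elim conjE allE)
  have mean: "(\<integral>\<^sup>+\<omega>. emeasure (\<Phi> \<omega>) B \<partial>M) = emeasure \<Lambda> B"
    if B [measurable]: "B \<in> sets borel" and "bounded B" for B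
  proof -
    have "(\<integral>\<^sup>+\<omega>. emeasure (\<Phi> \<omega>) B \<partial>M) = ennreal (measure \<Lambda> B)"
    proof (rule nn_integral_poisson)
      show "emeasure (\<Phi> \<omega>) B \<in> \<nat>" if "\<omega> \<in> space M" for \<omega>
        using measurable_space[OF measurable_germ_process that] \<open>B \<in> sets borel\<close> \<open>bounded B\<close>
        by (rule config_bounded_Nats)
    qed (use poisson that in auto)
    then show ?thesis
      using fin[OF that] by (simp add: emeasure_eq_ennreal_measure)
  qed
  have shift: "emeasure \<Lambda> (ball y 1) = emeasure \<Lambda> (ball 0 1)" for y
  proof -
    have T: "(\<lambda>\<omega>. translate_config y (\<Phi> \<omega>)) \<in> measurable M config_algebra"
      by measurable
    have "(\<integral>\<^sup>+\<omega>. emeasure (translate_config y (\<Phi> \<omega>)) (ball y 1) \<partial>M)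
        = (\<integral>\<^sup>+\<mu>. emeasure \<mu> (ball y 1) \<partial>distr M config_algebra (\<lambda>\<omega>. translate_config y (\<Phi> \<omega>)))"
      using T by (simp add: nn_integral_distr)
    also have "\<dots> = (\<integral>\<^sup>+\<mu>. emeasure \<mu> (ball y 1) \<partial>distr M config_algebra \<Phi>)"
      using germs_stationary unfolding stationary_process_def by metis
    also have "\<dots> = (\<integral>\<^sup>+\<omega>. emeasure (\<Phi> \<omega>) (ball y 1) \<partial>M)"
      by (simp add: nn_integral_distr)
    also have "\<dots> = emeasure \<Lambda> (ball y 1)"
      by (rule mean) auto
    also have "(\<integral>\<^sup>+\<omega>. emeasure (translate_config y (\<Phi> \<omega>)) (ball y 1) \<partial>M) = (\<integral>\<^sup>+\<omega>. emeasure (\<Phi> \<omega>) (ball 0 1) \<partial>M)"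
    proof (rule nn_integral_cong)
      fix \<omega> assume "\<omega> \<in> space M"
      then have "sets (\<Phi> \<omega>) = sets borel"
        using measurable_space[OF measurable_germ_process] by (intro sets_config)
      moreover have "(\<lambda>z. y + z) -` ball y 1 = ball 0 1"
        by (simp add: set_eq_iff dist_norm)
      ultimately show "emeasure (translate_config y (\<Phi> \<omega>)) (ball y 1) = emeasure (\<Phi> \<omega>) (ball 0 1)"
        by (simp add: emeasure_translate_config)
    qed
    also have "\<dots> = emeasure \<Lambda> (ball 0 1)"
      by (rule mean) auto
    finally show ?thesis by simp
  qed
  show thesis
  proof
    show "measure \<Lambda> (ball 0 1) \<ge> 0"
      by simp
    fix a :: 'b and r :: real assume r: "r \<ge> 0"
    have [measurable]: "cball a r \<in> sets borel"
      by simp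
    have "(\<Sum>n. emeasure M {\<omega>\<in>space M. X n \<omega> \<in> cball a r})
        = (\<Sum>n. \<integral>\<^sup>+\<omega>. indicator {\<omega>\<in>space M. X n \<omega> \<in> cball a r} \<omega> \<partial>M)"
      by (intro suminf_cong nn_integral_indicator[symmetric]) measurable
    also have "\<dots> = (\<integral>\<^sup>+\<omega>. (\<Sum>n. indicator {\<omega>\<in>space M. X n \<omega> \<in> cball a r} \<omega>) \<partial>M)"
      by (intro nn_integral_suminf[symmetric]) measurable
    also have "\<dots> = (\<integral>\<^sup>+\<omega>. emeasure (\<Phi> \<omega>) (cball a r) \<partial>M)"
    proof (rule nn_integral_cong_AE)
      show "AE \<omega> in M. (\<Sum>n. indicator {\<omega>\<in>space M. X n \<omega> \<in> cball a r} \<omega>) = emeasure (\<Phi> \<omega>) (cball a r)"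
        using AE_space germs_eq
        by eventually_elim (simp add: emeasure_superpose indicator_def)
    qed
    also have "\<dots> = emeasure \<Lambda> (cball a r)"
      by (rule mean) auto
    also have "\<dots> \<le> emeasure \<Lambda> (ball 0 1) * ennreal ((r + 1) ^ DIM('b))"
    proof (rule emeasure_cball_le_of_ball[OF \<Lambda> _ _ r])
      show "emeasure \<Lambda> (cball 0 r) < \<infinity>" for r
        by (rule fin) auto
      show "emeasure \<Lambda> (ball y 1) \<le> emeasure \<Lambda> (ball 0 1)" for y
        using shift[of y] by (rule eq_refl)
    qed
    also have "\<dots> = ennreal (measure \<Lambda> (ball 0 1) * (r + 1) ^ DIM('b))"
      using fin[of "ball 0 1"] r by (simp add: emeasure_eq_ennreal_measure ennreal_mult)
    finally show "(\<Sum>n. emeasure M {\<omega>\<in>space M. X n \<omega> \<in> cball a r})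
        \<le> ennreal (measure \<Lambda> (ball 0 1) * (r + 1) ^ DIM('b))" .
  qed
qed

section \<open>Grains reaching a set from far away\<close>

context germ_grain_model
begin

lemma prob_germ_grain:
  assumes S [measurable]: "S \<in> sets borel" and U [measurable]: "U \<in> sets config_algebra"
  shows "prob {\<omega>\<in>space M. X n \<omega> \<in> S \<and> G n \<omega> \<in> U}
    = prob {\<omega>\<in>space M. X n \<omega> \<in> S} * prob {\<omega>\<in>space M. G n \<omega> \<in> U}"
proof -
  let ?S = "{f \<in> space (Pi\<^sub>M UNIV (\<lambda>_. borel)). f n \<in> S}"
  let ?U = "{f \<in> space (Pi\<^sub>M UNIV (\<lambda>_. config_algebra)). f n \<in> U}"
  have "?S \<in> sets (Pi\<^sub>M UNIV (\<lambda>_. borel))" "?U \<in> sets (Pi\<^sub>M UNIV (\<lambda>_. config_algebra))"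
    by measurable
  then have "prob (((\<lambda>\<omega> n. X n \<omega>) -` ?S \<inter> space M) \<inter> ((\<lambda>\<omega> n. G n \<omega>) -` ?U \<inter> space M))
      = prob ((\<lambda>\<omega> n. X n \<omega>) -` ?S \<inter> space M) * prob ((\<lambda>\<omega> n. G n \<omega>) -` ?U \<inter> space M)"
    by (intro indep_setD[OF germs_grains_indep]) blast+
  moreover have "(\<lambda>\<omega> n. X n \<omega>) -` ?S \<inter> space M = {\<omega>\<in>space M. X n \<omega> \<in> S}"
    using measurable_space[OF measurable_germs] by auto
  moreover have "(\<lambda>\<omega> n. G n \<omega>) -` ?U \<inter> space M = {\<omega>\<in>space M. G n \<omega> \<in> U}"
    using measurable_space[OF measurable_grains] by auto
  moreover have "{\<omega>\<in>space M. X n \<omega> \<in> S} \<inter> {\<omega>\<in>space M. G n \<omega> \<in> U}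
      = {\<omega>\<in>space M. X n \<omega> \<in> S \<and> G n \<omega> \<in> U}"
    by auto
  ultimately show ?thesis
    by simp
qed

text \<open>
  Some grain with its germ in the shell at distance between \<open>k\<close> and \<open>k + 1\<close> from \<open>A\<close>, where
  \<open>k = k\<^sub>0 + j\<close>, has points outside the ball of radius \<open>k - 1\<close>.  The radius is smaller than \<open>k\<close> because
  a closed ball of radius \<open>k\<close> could contain a point by which the grain touches \<open>A\<close>.
\<close>

definition far_hits :: "'a set \<Rightarrow> nat \<Rightarrow> 'w set" where
  "far_hits A k\<^sub>0 = (\<Union>j n. {\<omega>\<in>space M.
      real (k\<^sub>0 + j) \<le> infdist (X n \<omega>) A \<and> infdist (X n \<omega>) A < real (k\<^sub>0 + j) + 1
      \<and> emeasure (G n \<omega>) (- cball 0 (real (k\<^sub>0 + j) - 1)) \<noteq> 0})"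

lemma measurable_infdist_germ [measurable]: "(\<lambda>\<omega>. infdist (X n \<omega>) A) \<in> borel_measurable M"
proof -
  have "(\<lambda>x. infdist x A) \<in> borel_measurable borel"
    by (intro borel_measurable_continuous_onI continuous_on_infdist continuous_on_id)
  then show ?thesis
    by (rule measurable_compose[OF measurable_germ])
qed

lemma sets_far_hits [measurable]: "far_hits A k\<^sub>0 \<in> events"
proof -
  have [measurable]: "- cball 0 r \<in> sets borel" for r :: real
    by (auto intro: borel_comp)
  show ?thesis
    unfolding far_hits_def by measurable
qed

lemma far_grains_miss:
  assumes A: "A \<in> sets borel" "A \<noteq> {}" and \<omega>: "\<omega> \<in> space M - far_hits A k\<^sub>0"
    and n: "real k\<^sub>0 \<le> infdist (X n \<omega>) A"
  shows "emeasure (translate_config (X n \<omega>) (G n \<omega>)) A = 0"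
proof -
  define k where "k = nat \<lfloor>infdist (X n \<omega>) A\<rfloor>"
  have k: "real k \<le> infdist (X n \<omega>) A" "infdist (X n \<omega>) A < real k + 1"
    using infdist_nonneg[of "X n \<omega>" A] by (simp_all add: k_def)
  have "k\<^sub>0 \<le> k"
    using k(2) n by linarith
  then obtain j where j: "k = k\<^sub>0 + j"
    using le_Suc_ex by blast
  have zero: "emeasure (G n \<omega>) (- cball 0 (real k - 1)) = 0"
    using \<omega> k unfolding far_hits_def j by blast
  have "(\<lambda>y. X n \<omega> + y) -` A \<subseteq> - cball 0 (real k - 1)"
  proof
    fix y assume "y \<in> (\<lambda>y. X n \<omega> + y) -` A"
    then have "infdist (X n \<omega>) A \<le> dist (X n \<omega>) (X n \<omega> + y)"
      by (intro infdist_le) simp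
    then show "y \<in> - cball 0 (real k - 1)"
      using k(1) by (simp add: dist_norm)
  qed
  moreover have sets: "sets (G n \<omega>) = sets borel"
    using measurable_space[OF measurable_grain] \<omega> by (intro sets_config) blast
  moreover have "- cball 0 (real k - 1) \<in> sets (G n \<omega>)"
    unfolding sets by (auto intro: borel_comp)
  ultimately have "emeasure (G n \<omega>) ((\<lambda>y. X n \<omega> + y) -` A) \<le> 0"
    using emeasure_mono[of "(\<lambda>y. X n \<omega> + y) -` A" "- cball 0 (real k - 1)" "G n \<omega>"] zero by simp
  then show ?thesis
    using sets A by (simp add: emeasure_translate_config)
qed

end

lemma power_mult_exp_bounded:
  fixes c :: real
  assumes "c > 0" "d > 0"
  obtains T where "T > 0" "\<And>k::nat. (real k + 3) ^ d * exp (- c * real k) \<le> T"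
proof
  \<comment> \<open>From \<open>(1 + y / d) ^ d \<le> exp y\<close> at \<open>y = c * k\<close>, after bounding \<open>k + 3\<close> by a multiple of
    \<open>1 + y / d\<close>.\<close>
  define b where "b = 3 * max 1 (real d / c)"
  show "b ^ d > 0"
    by (simp add: b_def)
  fix k :: nat
  have "real k = (real d / c) * (c * real k / real d)"
    using assms by simp
  also have "\<dots> \<le> max 1 (real d / c) * (c * real k / real d)"
    using assms by (intro mult_right_mono) auto
  finally have k: "real k \<le> max 1 (real d / c) * (c * real k / real d)" .
  have "b * (1 + c * real k / real d)
      = 3 * max 1 (real d / c) + 3 * (max 1 (real d / c) * (c * real k / real d))"
    unfolding b_def distrib_left by (simp only: mult_1_right mult.assoc)
  with k have "real k + 3 \<le> b * (1 + c * real k / real d)"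
    by linarith
  then have "(real k + 3) ^ d \<le> (b * (1 + c * real k / real d)) ^ d"
    by (intro power_mono) auto
  also have "\<dots> = b ^ d * (1 + c * real k / real d) ^ d"
    by (rule power_mult_distrib)
  also have "\<dots> \<le> b ^ d * exp (c * real k)"
    using assms by (intro mult_left_mono exp_ge_one_plus_x_over_n_power_n) (auto simp: b_def intro: order_trans[of _ 0])
  finally have "(real k + 3) ^ d * exp (- c * real k) \<le> b ^ d * exp (c * real k) * exp (- c * real k)"
    by (intro mult_right_mono) auto
  then show "(real k + 3) ^ d * exp (- c * real k) \<le> b ^ d"
    by (simp add: mult.assoc exp_add[symmetric])
qed

text \<open>
  Union bound over the shells and the germs.  The constant \<open>Q\<close> does not depend on the set, which enters
  through its diameter bound \<open>D\<close> only.
\<close>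

lemma (in boolean_model) prob_far_hits_le:
  fixes r\<^sub>0 C\<^sub>1 C\<^sub>2 :: real
  assumes C: "C\<^sub>1 > 0" "C\<^sub>2 > 0"
    and tail: "\<And>n r. r \<ge> r\<^sub>0 \<Longrightarrow>
      prob {\<omega>\<in>space M. emeasure (G n \<omega>) (- cball 0 r) \<noteq> 0} \<le> C\<^sub>1 * exp (- C\<^sub>2 * r)"
  obtains Q where "Q > 0"
    "\<And>A D k\<^sub>0. A \<noteq> {} \<Longrightarrow> (\<And>x y. x \<in> A \<Longrightarrow> y \<in> A \<Longrightarrow> norm (x - y) \<le> D) \<Longrightarrow> real k\<^sub>0 \<ge> r\<^sub>0 + 1 \<Longrightarrow>
      prob (far_hits A k\<^sub>0) \<le> Q * max D 1 ^ DIM('b) * exp (- (C\<^sub>2 / 2) * real k\<^sub>0)"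
proof -
  obtain m where m: "m \<ge> 0"
    "\<And>a r. r \<ge> 0 \<Longrightarrow> (\<Sum>n. emeasure M {\<omega>\<in>space M. X n \<omega> \<in> cball a r}) \<le> ennreal (m * (r + 1) ^ DIM('b))"
    using expected_germs_cball by blast
  obtain T where T: "T > 0" "\<And>k::nat. (real k + 3) ^ DIM('b) * exp (- (C\<^sub>2 / 2) * real k) \<le> T"
    using power_mult_exp_bounded[of "C\<^sub>2 / 2" "DIM('b)"] C by auto
  define q where "q = exp (- (C\<^sub>2 / 2))"
  have q: "0 < q" "q < 1"
    using C by (auto simp: q_def)
  define P where "P = C\<^sub>1 * exp C\<^sub>2 * m * T"
  have P: "P \<ge> 0"
    using C m T by (simp add: P_def)
  \<comment> \<open>Adding \<open>1\<close> makes \<open>Q\<close> positive when there are no germs.\<close>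
  define Q where "Q = (P + 1) / (1 - q)"
  show thesis
  proof
    show "Q > 0"
      using P q by (simp add: Q_def)
    fix A :: "'b set" and D :: real and k\<^sub>0 :: nat
    assume A: "A \<noteq> {}" and D: "\<And>x y. x \<in> A \<Longrightarrow> y \<in> A \<Longrightarrow> norm (x - y) \<le> D" and k0: "real k\<^sub>0 \<ge> r\<^sub>0 + 1"
    obtain a where a: "a \<in> A"
      using A by blast
    have D0: "D \<ge> 0"
      using D[OF a a] by simp
    let ?d = "DIM('b)"
    let ?N = "\<lambda>j n. {\<omega>\<in>space M. real (k\<^sub>0 + j) \<le> infdist (X n \<omega>) A \<and> infdist (X n \<omega>) A < real (k\<^sub>0 + j) + 1
      \<and> emeasure (G n \<omega>) (- cball 0 (real (k\<^sub>0 + j) - 1)) \<noteq> 0}"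
    have compl [measurable]: "- cball 0 r \<in> sets borel" for r :: real
      by (auto intro: borel_comp)
    have N_m [measurable]: "?N j n \<in> events" for j n
      by measurable
    have N_le: "emeasure M (?N j n) \<le> emeasure M {\<omega>\<in>space M. X n \<omega> \<in> cball a (D + real (k\<^sub>0 + j) + 1)}
        * ennreal (C\<^sub>1 * exp (- C\<^sub>2 * (real (k\<^sub>0 + j) - 1)))" for j n
    proof -
      let ?k = "k\<^sub>0 + j"
      let ?U = "{\<mu> \<in> space config_algebra. emeasure \<mu> (- cball 0 (real ?k - 1)) \<noteq> 0}"
      have U [measurable]: "?U \<in> sets config_algebra"
        by measurable
      have [measurable]: "cball a (D + real ?k + 1) \<in> sets borel"
        by simp
      have U_eq: "{\<omega>\<in>space M. G n \<omega> \<in> ?U} = {\<omega>\<in>space M. emeasure (G n \<omega>) (- cball 0 (real ?k - 1)) \<noteq> 0}"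
        using measurable_space[OF measurable_grain] by auto
      have "X n \<omega> \<in> cball a (D + real ?k + 1)" if "infdist (X n \<omega>) A < real ?k + 1" for \<omega>
      proof -
        have "(INF b\<in>A. dist (X n \<omega>) b) < real ?k + 1"
          using that A by (simp add: infdist_notempty)
        then obtain b where b: "b \<in> A" "dist (X n \<omega>) b < real ?k + 1"
          using A by (subst (asm) cINF_less_iff) (auto intro!: bdd_belowI[of _ 0])
        have "dist a (X n \<omega>) \<le> dist a b + dist (X n \<omega>) b"
          by (rule dist_triangle2)
        then show ?thesis
          using D[OF a b(1)] b(2) by (simp add: dist_norm)
      qed
      then have "?N j n \<subseteq> {\<omega>\<in>space M. X n \<omega> \<in> cball a (D + real ?k + 1) \<and> G n \<omega> \<in> ?U}"
        using measurable_space[OF measurable_grain] by auto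
      then have "prob (?N j n) \<le> prob {\<omega>\<in>space M. X n \<omega> \<in> cball a (D + real ?k + 1) \<and> G n \<omega> \<in> ?U}"
        by (intro finite_measure_mono) measurable
      also have "\<dots> = prob {\<omega>\<in>space M. X n \<omega> \<in> cball a (D + real ?k + 1)} * prob {\<omega>\<in>space M. G n \<omega> \<in> ?U}"
        by (rule prob_germ_grain[OF _ U]) simp
      also have "\<dots> \<le> prob {\<omega>\<in>space M. X n \<omega> \<in> cball a (D + real ?k + 1)}
          * (C\<^sub>1 * exp (- C\<^sub>2 * (real ?k - 1)))"
        unfolding U_eq using k0 by (intro mult_left_mono tail) auto
      finally show ?thesis
        using C by (simp add: emeasure_eq_measure ennreal_mult[symmetric] ennreal_leI)
    qed
    have bound: "m * (D + real (k\<^sub>0 + j) + 1 + 1) ^ ?d * (C\<^sub>1 * exp (- C\<^sub>2 * (real (k\<^sub>0 + j) - 1)))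
        \<le> P * max D 1 ^ ?d * exp (- (C\<^sub>2 / 2) * real k\<^sub>0) * q ^ j" for j
    proof -
      let ?k = "real (k\<^sub>0 + j)"
      have "?k + 2 \<le> max D 1 * (?k + 2)"
        using mult_right_mono[of 1 "max D 1" "?k + 2"] by simp
      then have "D + ?k + 1 + 1 \<le> max D 1 * (?k + 3)"
        by (simp add: algebra_simps)
      then have "(D + ?k + 1 + 1) ^ ?d \<le> max D 1 ^ ?d * (?k + 3) ^ ?d"
        unfolding power_mult_distrib[symmetric] using D0 by (intro power_mono) auto
      \<comment> \<open>Half of the decay compensates the power of \<open>k\<close>, the other half remains.\<close>
      moreover have "exp (- C\<^sub>2 * (?k - 1))
          = exp C\<^sub>2 * exp (- (C\<^sub>2 / 2) * ?k) * (exp (- (C\<^sub>2 / 2) * real k\<^sub>0) * q ^ j)"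
        unfolding q_def exp_of_nat_mult[symmetric] exp_add[symmetric]
        by (simp add: field_simps)
      ultimately have "m * (D + ?k + 1 + 1) ^ ?d * (C\<^sub>1 * exp (- C\<^sub>2 * (?k - 1)))
          \<le> m * (max D 1 ^ ?d * (?k + 3) ^ ?d)
            * (C\<^sub>1 * (exp C\<^sub>2 * exp (- (C\<^sub>2 / 2) * ?k) * (exp (- (C\<^sub>2 / 2) * real k\<^sub>0) * q ^ j)))"
        using C m q by (simp only:) (intro mult_right_mono mult_left_mono; simp)
      also have "\<dots> = (C\<^sub>1 * exp C\<^sub>2 * m * max D 1 ^ ?d * exp (- (C\<^sub>2 / 2) * real k\<^sub>0) * q ^ j)
          * ((?k + 3) ^ ?d * exp (- (C\<^sub>2 / 2) * ?k))"
        by (simp only: mult_ac)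
      also have "\<dots> \<le> (C\<^sub>1 * exp C\<^sub>2 * m * max D 1 ^ ?d * exp (- (C\<^sub>2 / 2) * real k\<^sub>0) * q ^ j) * T"
        using C m q T(2)[of "k\<^sub>0 + j"] by (intro mult_left_mono) auto
      also have "\<dots> = P * max D 1 ^ ?d * exp (- (C\<^sub>2 / 2) * real k\<^sub>0) * q ^ j"
        by (simp only: P_def mult_ac)
      finally show ?thesis .
    qed
    let ?c = "P * max D 1 ^ ?d * exp (- (C\<^sub>2 / 2) * real k\<^sub>0)"
    have c: "?c \<ge> 0"
      using P by simp
    have "emeasure M (far_hits A k\<^sub>0) \<le> (\<Sum>j. emeasure M (\<Union>n. ?N j n))"
      unfolding far_hits_def by (rule emeasure_subadditive_countably) auto
    also have "\<dots> \<le> (\<Sum>j. \<Sum>n. emeasure M (?N j n))"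
      by (intro suminf_le emeasure_subadditive_countably) auto
    also have "\<dots> \<le> (\<Sum>j. ennreal (?c * q ^ j))"
    proof (intro suminf_le allI)
      fix j
      let ?e = "C\<^sub>1 * exp (- C\<^sub>2 * (real (k\<^sub>0 + j) - 1))"
      have "(\<Sum>n. emeasure M (?N j n))
          \<le> (\<Sum>n. emeasure M {\<omega>\<in>space M. X n \<omega> \<in> cball a (D + real (k\<^sub>0 + j) + 1)} * ennreal ?e)"
        by (intro suminf_le N_le) auto
      also have "\<dots> = (\<Sum>n. emeasure M {\<omega>\<in>space M. X n \<omega> \<in> cball a (D + real (k\<^sub>0 + j) + 1)}) * ennreal ?e"
        by simp
      also have "\<dots> \<le> ennreal (m * (D + real (k\<^sub>0 + j) + 1 + 1) ^ ?d) * ennreal ?e"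
        using D0 by (intro mult_right_mono m) auto
      also have "\<dots> = ennreal (m * (D + real (k\<^sub>0 + j) + 1 + 1) ^ ?d * ?e)"
        using m(1) D0 C by (intro ennreal_mult[symmetric]) auto
      also have "\<dots> \<le> ennreal (?c * q ^ j)"
        by (intro ennreal_leI bound)
      finally show "(\<Sum>n. emeasure M (?N j n)) \<le> ennreal (?c * q ^ j)" .
    qed auto
    also have "\<dots> = ennreal (?c * (1 / (1 - q)))"
      using q c by (intro suminf_ennreal_eq sums_mult geometric_sums) auto
    also have "\<dots> \<le> ennreal (Q * max D 1 ^ ?d * exp (- (C\<^sub>2 / 2) * real k\<^sub>0))"
    proof (rule ennreal_leI)
      have "?c * (1 / (1 - q)) = P / (1 - q) * (max D 1 ^ ?d * exp (- (C\<^sub>2 / 2) * real k\<^sub>0))"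
        by simp
      also have "\<dots> \<le> Q * (max D 1 ^ ?d * exp (- (C\<^sub>2 / 2) * real k\<^sub>0))"
        using q by (intro mult_right_mono) (auto simp: Q_def divide_right_mono)
      finally show "?c * (1 / (1 - q)) \<le> Q * max D 1 ^ ?d * exp (- (C\<^sub>2 / 2) * real k\<^sub>0)"
        by (simp only: mult.assoc)
    qed
    finally show "prob (far_hits A k\<^sub>0) \<le> Q * max D 1 ^ ?d * exp (- (C\<^sub>2 / 2) * real k\<^sub>0)"
      using \<open>Q > 0\<close> by (simp add: emeasure_eq_measure)
  qed
qed

section \<open>Exponential decay of the mixing coefficients\<close>

text \<open>
  The regions are the neighbourhoods of \<open>A\<close> and \<open>B\<close> of radius \<open>s / 2\<close>, which are disjoint by the triangle
  inequality and bounded.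
\<close>

lemma (in boolean_model) beta_mixing_le_far_hits:
  assumes A: "A \<in> sets borel" "bounded A" "A \<noteq> {}" and B: "B \<in> sets borel" "bounded B" "B \<noteq> {}"
    and sep: "\<And>x y. x \<in> A \<Longrightarrow> y \<in> B \<Longrightarrow> s \<le> norm (x - y)" and k: "real k \<le> s / 2"
  shows "beta_mixing M \<Xi> A B \<le> ennreal (2 * (prob (far_hits A k) + prob (far_hits B k)))"
proof -
  let ?K = "\<lambda>S. {x. infdist x S < s / 2}"
  have K_sets: "?K S \<in> sets borel" for S :: "'b set"
  proof -
    have "open (?K S)"
      by (intro open_Collect_less continuous_intros)
    then show ?thesis by simp
  qed
  have near: "\<exists>z\<in>S. dist x z < s / 2" if "x \<in> ?K S" "S \<noteq> {}" for x and S :: "'b set"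
  proof -
    have "(INF z\<in>S. dist x z) < s / 2"
      using that by (simp add: infdist_notempty)
    then show ?thesis
      using that(2) by (subst (asm) cINF_less_iff) (auto intro!: bdd_belowI[of _ 0])
  qed
  have K_bounded: "bounded (?K S)" if S: "bounded S" "S \<noteq> {}" for S :: "'b set"
  proof -
    obtain r where r: "\<And>z. z \<in> S \<Longrightarrow> norm z \<le> r"
      using S(1) by (auto simp: bounded_iff)
    have "norm x \<le> r + s / 2" if x: "x \<in> ?K S" for x
    proof -
      obtain z where z: "z \<in> S" "dist x z < s / 2"
        using near[OF x S(2)] by blast
      have "norm x \<le> norm z + norm (x - z)"
        by (rule norm_triangle_sub)
      then show ?thesis
        using r[OF z(1)] z(2) by (simp add: dist_norm)
    qed
    then show ?thesis
      by (auto simp: bounded_iff)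
  qed
  have disj: "?K A \<inter> ?K B = {}"
  proof (rule ccontr)
    assume "?K A \<inter> ?K B \<noteq> {}"
    then obtain x where x: "x \<in> ?K A" "x \<in> ?K B"
      by blast
    obtain a b where ab: "a \<in> A" "dist x a < s / 2" "b \<in> B" "dist x b < s / 2"
      using near[OF x(1) A(3)] near[OF x(2) B(3)] by blast
    have "norm (a - b) < s"
      using dist_triangle_half_l[of a x s b] ab by (simp add: dist_norm norm_minus_commute)
    then show False
      using sep[OF ab(1,3)] by simp
  qed
  \<comment> \<open>The null set on which \<open>\<Xi>\<close> is not the superposition of the grains is added to the bad event.\<close>
  have exceptional: "\<exists>H\<in>events. prob H \<le> prob (far_hits S k) \<and>
      (\<forall>\<omega>\<in>space M - H. restrict_config S (\<Xi> \<omega>) = cluster_process (?K S) S \<omega>)"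
    if S: "S \<in> sets borel" "bounded S" "S \<noteq> {}" for S
  proof -
    obtain N where N: "N \<in> null_sets M" "{\<omega>\<in>space M. \<not> ((\<forall>n. X n \<omega> \<notin> ?K S \<longrightarrow>
        emeasure (translate_config (X n \<omega>) (G n \<omega>)) S = 0) \<longrightarrow>
        restrict_config S (\<Xi> \<omega>) = cluster_process (?K S) S \<omega>)} \<subseteq> N"
      using AE_eq_cluster_process[OF K_sets K_bounded[OF S(2,3)] S(1)]
      by (auto elim!: AE_E simp: null_sets_def)
    show ?thesis
    proof (intro bexI[of _ "far_hits S k \<union> N"] conjI ballI)
      show "far_hits S k \<union> N \<in> events"
        using N(1) by auto
      have "prob (far_hits S k \<union> N) \<le> prob (far_hits S k) + prob N"
        using N(1) by (intro measure_Un_le) auto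
      then show "prob (far_hits S k \<union> N) \<le> prob (far_hits S k)"
        using N(1) by (simp add: measure_eq_0_null_sets)
      fix \<omega> assume \<omega>: "\<omega> \<in> space M - (far_hits S k \<union> N)"
      have "emeasure (translate_config (X n \<omega>) (G n \<omega>)) S = 0" if "X n \<omega> \<notin> ?K S" for n
        using \<omega> that k by (intro far_grains_miss[OF S(1,3), of _ k]) auto
      then show "restrict_config S (\<Xi> \<omega>) = cluster_process (?K S) S \<omega>"
        using N(2) \<omega> by blast
    qed
  qed
  obtain H1 where H1: "H1 \<in> events" "prob H1 \<le> prob (far_hits A k)"
    "\<forall>\<omega>\<in>space M - H1. restrict_config A (\<Xi> \<omega>) = cluster_process (?K A) A \<omega>"
    using exceptional[OF A] by blast
  obtain H2 where H2: "H2 \<in> events" "prob H2 \<le> prob (far_hits B k)"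
    "\<forall>\<omega>\<in>space M - H2. restrict_config B (\<Xi> \<omega>) = cluster_process (?K B) B \<omega>"
    using exceptional[OF B] by blast
  have indep: "indep_var config_algebra (cluster_process (?K A) A) config_algebra (cluster_process (?K B) B)"
    using K_sets K_bounded[OF A(2,3)] K_bounded[OF B(2,3)] disj A(1) B(1)
    by (intro indep_cluster_processes)
  have "beta_mixing M \<Xi> A B \<le> ennreal (2 * (prob H1 + prob H2))"
  proof (rule beta_mixing_le_of_coupling)
    show "\<Xi> \<in> measurable M config_algebra"
      using point_process_model by (simp add: point_process_def)
    show "cluster_process (?K A) A \<in> measurable M config_algebra"
      "cluster_process (?K B) B \<in> measurable M config_algebra"
      using indep by (auto dest: indep_var_rv1 indep_var_rv2)
    fix U V :: "'b measure set" assume "U \<in> sets config_algebra" "V \<in> sets config_algebra"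
    then have "prob ((\<lambda>\<omega>. (cluster_process (?K A) A \<omega>, cluster_process (?K B) B \<omega>)) -` (U \<times> V) \<inter> space M)
        = prob (cluster_process (?K A) A -` U \<inter> space M) * prob (cluster_process (?K B) B -` V \<inter> space M)"
      by (rule indep_varD[OF indep])
    moreover have "(\<lambda>\<omega>. (cluster_process (?K A) A \<omega>, cluster_process (?K B) B \<omega>)) -` (U \<times> V) \<inter> space M
        = (cluster_process (?K A) A -` U \<inter> space M) \<inter> (cluster_process (?K B) B -` V \<inter> space M)"
      by auto
    ultimately show "prob ((cluster_process (?K A) A -` U \<inter> space M) \<inter> (cluster_process (?K B) B -` V \<inter> space M))
        = prob (cluster_process (?K A) A -` U \<inter> space M) * prob (cluster_process (?K B) B -` V \<inter> space M)"
      by simp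
  qed (use A B H1 H2 in auto)
  also have "\<dots> \<le> ennreal (2 * (prob (far_hits A k) + prob (far_hits B k)))"
    using H1(2) H2(2) by (intro ennreal_leI) simp
  finally show ?thesis .
qed

lemma norm_diff_le_enn2real_ediam:
  assumes "ediam A \<noteq> \<infinity>" "x \<in> A" "y \<in> A"
  shows "norm (x - y) \<le> enn2real (ediam A)"
proof -
  have "ennreal (norm (x - y)) \<le> ediam A"
    unfolding ediam_def using assms(2,3) by (intro SUP_upper2[of "(x, y)"]) auto
  then show ?thesis
    using assms(1) by (cases "ediam A" rule: ennreal_cases) auto
qed

lemma powr_ext_max_1_ge:
  assumes "e \<noteq> \<infinity>"
  shows "ennreal (max (enn2real e) 1 ^ d) \<le> max (powr_ext e (real d)) 1"
proof (cases "enn2real e \<le> 1")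
  case True
  then show ?thesis by simp
next
  case False
  then have "enn2real e powr real d = max (enn2real e) 1 ^ d"
    by (simp add: powr_realpow max_def)
  then show ?thesis
    using assms by (simp add: powr_ext_def)
qed

theorem lemma3p4:
  fixes M :: "'w measure"
    and X :: "nat \<Rightarrow> 'w \<Rightarrow> 'a::euclidean_space"
    and G :: "nat \<Rightarrow> 'w \<Rightarrow> 'a measure"
    and \<Phi> \<Xi> :: "'w \<Rightarrow> 'a measure"
  assumes "boolean_model M X G \<Phi> \<Xi>"
    and "\<exists>r\<^sub>0 C\<^sub>1 C\<^sub>2 :: real. r\<^sub>0 > 0 \<and> C\<^sub>1 > 0 \<and> C\<^sub>2 > 0 \<and>
      (\<forall>n. \<forall>r\<ge>r\<^sub>0.
        measure M {\<omega>\<in>space M. restrict_config (- cball 0 r) (G n \<omega>) \<noteq> null_measure borel}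
          \<le> C\<^sub>1 * exp (- C\<^sub>2 * r))"
  shows "EDD M \<Xi>"
proof -
  interpret boolean_model M X G \<Phi> \<Xi> by fact
  obtain r\<^sub>0 C\<^sub>1 C\<^sub>2 :: real where C: "r\<^sub>0 > 0" "C\<^sub>1 > 0" "C\<^sub>2 > 0"
    and tail: "\<And>n r. r \<ge> r\<^sub>0 \<Longrightarrow>
      prob {\<omega>\<in>space M. restrict_config (- cball 0 r) (G n \<omega>) \<noteq> null_measure borel} \<le> C\<^sub>1 * exp (- C\<^sub>2 * r)"
    using assms(2) by blast
  have null_iff: "restrict_config (- cball 0 r) (G n \<omega>) \<noteq> null_measure borel
      \<longleftrightarrow> emeasure (G n \<omega>) (- cball 0 r) \<noteq> 0" if "\<omega> \<in> space M" for n r \<omega>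
  proof -
    have sets: "sets (G n \<omega>) = sets borel"
      using measurable_space[OF measurable_grain that] by (rule sets_config)
    have compl: "- cball 0 r \<in> sets (borel :: 'a measure)"
      by (auto intro: borel_comp)
    have "restrict_config (- cball 0 r) (G n \<omega>) = null_measure borel"
      if zero: "emeasure (G n \<omega>) (- cball 0 r) = 0"
    proof (rule measure_eqI)
      fix S assume "S \<in> sets (restrict_config (- cball 0 r) (G n \<omega>))"
      then have S: "S \<in> sets borel"
        using sets by simp
      have "emeasure (G n \<omega>) (- cball 0 r \<inter> S) \<le> emeasure (G n \<omega>) (- cball 0 r)"
        using sets compl by (intro emeasure_mono) auto
      then show "emeasure (restrict_config (- cball 0 r) (G n \<omega>)) S = emeasure (null_measure borel) S"
        using zero S compl sets by (simp add: emeasure_restrict_config)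
    qed (simp add: sets)
    moreover have "emeasure (restrict_config (- cball 0 r) (G n \<omega>)) UNIV = emeasure (G n \<omega>) (- cball 0 r)"
      using compl sets by (simp add: emeasure_restrict_config)
    ultimately show ?thesis
      by auto
  qed
  have "prob {\<omega>\<in>space M. emeasure (G n \<omega>) (- cball 0 r) \<noteq> 0} \<le> C\<^sub>1 * exp (- C\<^sub>2 * r)"
    if "r \<ge> r\<^sub>0" for n r
    using tail[OF that, of n] by (simp add: null_iff cong: conj_cong)
  then obtain Q where Q: "Q > 0"
    and far: "\<And>A D k. A \<noteq> {} \<Longrightarrow> (\<And>x y. x \<in> A \<Longrightarrow> y \<in> A \<Longrightarrow> norm (x - y) \<le> D) \<Longrightarrow> real k \<ge> r\<^sub>0 + 1 \<Longrightarrow>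
      prob (far_hits A k) \<le> Q * max D 1 ^ DIM('a) * exp (- (C\<^sub>2 / 2) * real k)"
    using prob_far_hits_le[OF C(2,3)] by blast
  define c where "c = 4 * Q * exp (C\<^sub>2 / 2)"
  \<comment> \<open>The distance condition enters through \<open>\<theta>\<^sub>4 = exp (2 * r\<^sub>0 + 4)\<close>, which forces \<open>s \<ge> 2 * r\<^sub>0 + 4\<close>, so that
    the tail bound applies from the first shell on, and through the finiteness of both diameters.\<close>
  have bound: "beta_mixing M \<Xi> A B
      \<le> ennreal c * max (powr_ext (ediam A) (real DIM('a))) 1 * max (powr_ext (ediam B) (real DIM('a))) 1
        * exp_ext (- ereal (C\<^sub>2 / 4) * enn2ereal (esetdist A B))"
    if A: "A \<in> sets borel" and B: "B \<in> sets borel"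
      and far_apart: "enn2ereal (esetdist A B)
        \<ge> ereal 1 * ln_ext (max (max (ediam A) (ediam B)) (ennreal (exp (2 * r\<^sub>0 + 4))))" for A B
  proof (cases "A = {} \<or> B = {}")
    case True
    have "\<Xi> \<in> measurable M config_algebra"
      using point_process_model by (simp add: point_process_def)
    then show ?thesis
      using beta_mixing_empty[OF _ A B True] by simp
  next
    case False
    then have ne: "A \<noteq> {}" "B \<noteq> {}"
      by auto
    then obtain a b where ab: "a \<in> A" "b \<in> B"
      by blast
    have "esetdist A B \<le> ennreal (norm (a - b))"
      unfolding esetdist_def using ab by (intro INF_lower2[of "(a, b)"]) auto
    then have "esetdist A B < \<infinity>"
      by (simp add: le_less_trans)
    then obtain s where s: "esetdist A B = ennreal s" "s \<ge> 0"
      by (cases "esetdist A B" rule: ennreal_cases) auto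
    let ?m = "max (max (ediam A) (ediam B)) (ennreal (exp (2 * r\<^sub>0 + 4)))"
    have m_fin: "?m \<noteq> \<infinity>"
    proof
      assume "?m = \<infinity>"
      then show False
        using far_apart s by (simp add: ln_ext_def)
    qed
    have "ediam A \<le> ?m" "ediam B \<le> ?m"
      by (simp_all add: le_max_iff_disj)
    with m_fin have fin: "ediam A \<noteq> \<infinity>" "ediam B \<noteq> \<infinity>"
      by (metis infinity_ennreal_def top.extremum_uniqueI)+
    define D1 D2 where "D1 = enn2real (ediam A)" and "D2 = enn2real (ediam B)"
    have D: "\<And>x y. x \<in> A \<Longrightarrow> y \<in> A \<Longrightarrow> norm (x - y) \<le> D1" "\<And>x y. x \<in> B \<Longrightarrow> y \<in> B \<Longrightarrow> norm (x - y) \<le> D2"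
      using fin by (auto simp: D1_def D2_def intro: norm_diff_le_enn2real_ediam)
    have bdd: "bounded S" if "z \<in> S" "\<And>x y. x \<in> S \<Longrightarrow> y \<in> S \<Longrightarrow> norm (x - y) \<le> r" for z r and S :: "'a set"
    proof -
      have "S \<subseteq> cball z r"
        using that by (auto simp: dist_norm)
      then show ?thesis
        using bounded_cball bounded_subset by blast
    qed
    have "ennreal (exp (2 * r\<^sub>0 + 4)) \<le> ?m"
      by simp
    then have "exp (2 * r\<^sub>0 + 4) \<le> enn2real ?m"
      using m_fin by (cases ?m rule: ennreal_cases) auto
    then have "2 * r\<^sub>0 + 4 \<le> ln (enn2real ?m)"
      by (subst ln_ge_iff) (auto intro: less_le_trans[OF exp_gt_zero])
    also have "\<dots> \<le> s"
      using far_apart m_fin s by (simp add: ln_ext_def)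
    finally have s_ge: "2 * r\<^sub>0 + 4 \<le> s" .
    have sep: "s \<le> norm (x - y)" if "x \<in> A" "y \<in> B" for x y
    proof -
      have "esetdist A B \<le> ennreal (norm (x - y))"
        unfolding esetdist_def using that by (intro INF_lower2[of "(x, y)"]) auto
      then show ?thesis
        using s by simp
    qed
    define k where "k = nat \<lfloor>s / 2\<rfloor>"
    have "real k = of_int \<lfloor>s / 2\<rfloor>"
      using s(2) by (simp add: k_def)
    then have k: "real k \<le> s / 2" "s / 2 - 1 \<le> real k"
      by linarith+
    let ?d = "DIM('a)"
    let ?e = "exp (- (C\<^sub>2 / 2) * real k)"
    have k_ge: "real k \<ge> r\<^sub>0 + 1"
      using k(2) s_ge by simp
    define m1 m2 where "m1 = max D1 1 ^ ?d" and "m2 = max D2 1 ^ ?d"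
    have m1: "m1 \<ge> 1" and m2: "m2 \<ge> 1"
      by (simp_all add: m1_def m2_def)
    have "?e \<le> exp (C\<^sub>2 / 2) * exp (- (C\<^sub>2 / 4) * s)"
    proof -
      have "(C\<^sub>2 / 2) * (s / 2 - 1) \<le> (C\<^sub>2 / 2) * real k"
        using C k by (intro mult_left_mono) auto
      then show ?thesis
        unfolding exp_add[symmetric] by (simp add: algebra_simps)
    qed
    moreover have "m1 + m2 \<le> 2 * (m1 * m2)"
    proof -
      have "m1 * 1 \<le> m1 * m2" "1 * m2 \<le> m1 * m2"
        using m1 m2 by (intro mult_left_mono mult_right_mono; simp)+
      then show ?thesis by linarith
    qed
    ultimately have "(m1 + m2) * ?e \<le> 2 * (m1 * m2) * (exp (C\<^sub>2 / 2) * exp (- (C\<^sub>2 / 4) * s))"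
      using m1 m2 by (intro mult_mono) auto
    then have "2 * Q * ((m1 + m2) * ?e) \<le> 2 * Q * (2 * (m1 * m2) * (exp (C\<^sub>2 / 2) * exp (- (C\<^sub>2 / 4) * s)))"
      using Q by (intro mult_left_mono) auto
    moreover have "prob (far_hits A k) \<le> Q * m1 * ?e" "prob (far_hits B k) \<le> Q * m2 * ?e"
      unfolding m1_def m2_def using far[OF ne(1) D(1) k_ge] far[OF ne(2) D(2) k_ge] by blast+
    ultimately have real_bound: "2 * (prob (far_hits A k) + prob (far_hits B k))
        \<le> c * m1 * m2 * exp (- (C\<^sub>2 / 4) * s)"
      by (simp add: c_def algebra_simps)
    have "beta_mixing M \<Xi> A B \<le> ennreal (2 * (prob (far_hits A k) + prob (far_hits B k)))"
      using A B ne bdd[OF ab(1) D(1)] bdd[OF ab(2) D(2)] sep k(1)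
      by (intro beta_mixing_le_far_hits[where s=s]) auto
    also have "\<dots> \<le> ennreal (c * m1 * m2 * exp (- (C\<^sub>2 / 4) * s))"
      using real_bound by (rule ennreal_leI)
    also have "\<dots> = ennreal c * ennreal m1 * ennreal m2 * ennreal (exp (- (C\<^sub>2 / 4) * s))"
      using m1 m2 Q by (simp add: ennreal_mult c_def)
    also have "\<dots> \<le> ennreal c * max (powr_ext (ediam A) (real ?d)) 1 * max (powr_ext (ediam B) (real ?d)) 1
        * ennreal (exp (- (C\<^sub>2 / 4) * s))"
      unfolding m1_def m2_def D1_def D2_def
      by (intro mult_right_mono mult_mono powr_ext_max_1_ge fin order_refl) auto
    also have "ennreal (exp (- (C\<^sub>2 / 4) * s)) = exp_ext (- ereal (C\<^sub>2 / 4) * enn2ereal (esetdist A B))"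
      using s by (simp add: exp_ext_def enn2ereal_ennreal)
    finally show ?thesis .
  qed
  show ?thesis
    unfolding EDD_def
  proof (rule exI[of _ "real DIM('a)"], rule exI[of _ c], rule exI[of _ "C\<^sub>2 / 4"], rule exI[of _ 1],
      rule exI[of _ "exp (2 * r\<^sub>0 + 4)"], intro conjI ballI impI)
    show "c > 0"
      using Q by (simp add: c_def)
  qed (use C bound in simp_all)
qed

end
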